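(* Let $X(t)=L(\Theta(t))=(X_1(t),\dots,X_d(t))$, $X_j(t)=L_j(\Theta_j(t))$. Then $X$ is square integrable if and only if $X_j$ is square integrable for all $j=1,\dots,d$. Let $j\in\{1,\dots,d\}$. Then $X_j$ is square integrable if and only if at least one of the following statements holds: (1) $L_j$ and $\Theta_j$ are square integrable; (2) $L_j$ is mean zero and square integrable and $\Theta_j$ is integrable; (3) $\Theta_j=0$ a.s.; (4) $L_j=0$ a.s. Moreover, $X_j$ is mean zero and square integrable if and only if (2), (3) or (4) holds. If (1) holds for every $j=1,\dots,d$, then $$\mathrm{E}(X(1))=\mathrm{E}\Theta(1)\,\mathrm{E}L(1),$$ $$\mathrm{Cov}(X(1))=\mathrm{E}(\Theta(1))\,\mathrm{Cov}(L(1))+\sum_{i,j=1}^d\mathrm{Cov}(\Theta(1))_{i,j}\,(\mathrm{E}L_i(1))\otimes(\mathrm{E}L_j(1)),$$ where $x\otimes y:H\to H$, $z\mapsto\langle x|z\rangle y$ for $x,y\in H$. If (2) holds for every $j=1,\dots,d$, then $$\mathrm{Cov}(X(1))=\mathrm{E}(\Theta(1))\,\mathrm{Cov}(L(1)).$$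
   Context: Setting. $d\in\mathbb N$; for $j=1,\dots,d$, $(H_j,\langle\cdot|\cdot\rangle_j)$ is a separable real Hilbert space and $L_j$ is an $H_j$-valued càdlàg Lévy process; $L_1,\dots,L_d$ are independent. $H:=H_1\times\dots\times H_d$ with $\langle u|v\rangle=\sum_j\langle u_j|v_j\rangle_j$; $L=(L_1,\dots,L_d)$; $L(\theta):=(L_1(\theta_1),\dots,L_d(\theta_d))$ for $\theta\in\mathbb R_+^d$. $\Theta=(\Theta_1,\dots,\Theta_d)$ is an $\mathbb R^d$-valued càdlàg Lévy process, independent of $L$, such that each $\Theta_j$ is a subordinator (nondecreasing real Lévy process). A process $Y$ is integrable (square integrable) if $\mathrm{E}|Y(t)|<\infty$ (resp. $\mathrm{E}|Y(t)|^2<\infty$) for all $t\ge0$; it is mean zero if it is integrable and $\mathrm{E}Y(t)=0$ for all $t\ge 0$. For a square integrable $H$-valued random variable $Y$, $\mathrm{Cov}(Y)$ is the operator on $H$ with $\langle\mathrm{Cov}(Y)x|y\rangle=\mathrm{E}(\langle Y-\mathrm{E}Y|x\rangle\langle Y-\mathrm{E}Y|y\rangle)$; $\mathrm{Cov}(\Theta(1))_{i,j}$ is the $(i,j)$ entry of the covariance matrix of $\Theta(1)$. For $a\in\mathbb R^d$ and $u\in H$, $au:=(a_1u_1,\dots,a_du_d)$; for $T=T_1\times\dots\times T_d$ acting coordinatewise, $aT:=a_1T_1\times\dots\times a_dT_d$ (note $\mathrm{Cov}(L(1))=\mathrm{Cov}(L_1(1))\times\dots\times\mathrm{Cov}(L_d(1))$).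 In $(\mathrm{E}L_i(1))\otimes(\mathrm{E}L_j(1))$, elements of $H_i$ and $H_j$ are regarded as elements of $H$ via the natural coordinate embeddings. *)

theory Defs
  imports "HOL-Probability.Probability"
begin

(* The library has this only for a Euclidean component type.  It makes the Borel measurability and
   Bochner integration theory available for random variables with values in 'a ^ 'd. *)
instance vec :: ("{metric_space, second_countable_topology}", finite) second_countable_topology
proof
  obtain B :: "'a set set" where B: "countable B" "topological_basis B"
    using ex_countable_basis by auto
  let ?C = "(\<lambda>f. {y :: 'a ^ 'b. \<forall>i. y $ i \<in> f i}) ` (PiE UNIV (\<lambda>_. B))"
  have "countable ?C"
    using B(1) by (intro countable_image countable_PiE) auto
  moreover have "topological_basis ?C"
  proof (rule topological_basisI)
    fix S assume "S \<in> ?C"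
    then obtain f where f: "f \<in> PiE UNIV (\<lambda>_. B)" "S = {y. \<forall>i. y $ i \<in> f i}" by blast
    have "open (f i)" for i
      using topological_basis_open[OF B(2)] PiE_mem[OF f(1)] by simp
    then show "open S"
      unfolding f(2) open_vec_def by (intro ballI exI[of _ f]) simp
  next
    fix S :: "('a ^ 'b) set" and x assume "open S" "x \<in> S"
    then obtain A where A: "\<And>i. open (A i) \<and> x $ i \<in> A i"
      and AS: "\<And>y. (\<forall>i. y $ i \<in> A i) \<Longrightarrow> y \<in> S"
      using \<open>open S\<close>[unfolded open_vec_def, rule_format, OF \<open>x \<in> S\<close>] by blast
    have "\<exists>b. b \<in> B \<and> x $ i \<in> b \<and> b \<subseteq> A i" for i
      using topological_basisE[OF B(2), of "A i" "x $ i"] A[of i] by blast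
    then obtain f where "\<And>i. f i \<in> B \<and> x $ i \<in> f i \<and> f i \<subseteq> A i" by metis
    then have f: "f \<in> PiE UNIV (\<lambda>_. B)" "\<And>i. x $ i \<in> f i" "\<And>i. f i \<subseteq> A i" by auto
    show "\<exists>U\<in>?C. x \<in> U \<and> U \<subseteq> S"
    proof (rule bexI[OF _ imageI[OF f(1)]], intro conjI subsetI)
      show "x \<in> {y. \<forall>i. y $ i \<in> f i}" using f(2) by simp
    next
      fix y assume "y \<in> {y. \<forall>i. y $ i \<in> f i}"
      then have "\<forall>i. y $ i \<in> A i" using f(3) by blast
      then show "y \<in> S" by (rule AS)
    qed
  qed
  ultimately show "\<exists>B :: ('a ^ 'b) set set. countable B \<and> open = generate_topology B"
    by (intro exI[of _ ?C]) (simp add: topological_basis_imp_subbasis)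
qed


section \<open>Processes\<close>

text \<open>
  A process is a map \<open>Y :: real \<Rightarrow> 'w \<Rightarrow> 'b\<close> of which only the times \<open>t \<ge> 0\<close> are used.
\<close>

definition levy_process ::
    "'w measure \<Rightarrow> (real \<Rightarrow> 'w \<Rightarrow> 'b :: {real_normed_vector, second_countable_topology}) \<Rightarrow> bool"
where
  "levy_process M Y \<longleftrightarrow>
     (\<forall>t\<ge>0. Y t \<in> borel_measurable M) \<and>
     (AE \<omega> in M. Y 0 \<omega> = 0) \<and>
     (\<forall>n t. 0 \<le> t 0 \<and> (\<forall>i<n. t i \<le> t (Suc i)) \<longrightarrow>
        prob_space.indep_vars M (\<lambda>_. borel) (\<lambda>i \<omega>. Y (t (Suc i)) \<omega> - Y (t i) \<omega>) {..<n}) \<and>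
     (\<forall>s\<ge>0. \<forall>h\<ge>0. distr M borel (\<lambda>\<omega>. Y (s + h) \<omega> - Y s \<omega>) = distr M borel (Y h)) \<and>
     (\<forall>t\<ge>0. \<forall>\<epsilon>>0.
        ((\<lambda>s. measure M {\<omega> \<in> space M. \<epsilon> \<le> norm (Y s \<omega> - Y t \<omega>)}) \<longlongrightarrow> 0) (at t within {0..}))"

definition cadlag_process ::
    "'w measure \<Rightarrow> (real \<Rightarrow> 'w \<Rightarrow> 'b :: topological_space) \<Rightarrow> bool"
where
  "cadlag_process M Y \<longleftrightarrow>
     (\<forall>\<omega>\<in>space M.
        (\<forall>t\<ge>0. ((\<lambda>s. Y s \<omega>) \<longlongrightarrow> Y t \<omega>) (at_right t)) \<and>
        (\<forall>t>0. \<exists>l. ((\<lambda>s. Y s \<omega>) \<longlongrightarrow> l) (at_left t)))"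

text \<open>
  All values of a subordinator are required to be nonnegative, so that it can be used as a time
  change on the whole of \<open>space M\<close>; monotonicity together with \<open>Y 0 = 0\<close> almost surely gives this
  only almost surely.
\<close>

definition subordinator :: "'w measure \<Rightarrow> (real \<Rightarrow> 'w \<Rightarrow> real) \<Rightarrow> bool" where
  "subordinator M Y \<longleftrightarrow>
     levy_process M Y \<and>
     (\<forall>\<omega>\<in>space M. \<forall>t\<ge>0. 0 \<le> Y t \<omega>) \<and>
     (AE \<omega> in M. \<forall>s\<ge>0. \<forall>t\<ge>s. Y s \<omega> \<le> Y t \<omega>)"

definition integrable_process ::
    "'w measure \<Rightarrow> (real \<Rightarrow> 'w \<Rightarrow> 'b :: {banach, second_countable_topology}) \<Rightarrow> bool"
where
  "integrable_process M Y \<longleftrightarrow> (\<forall>t\<ge>0. integrable M (Y t))"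

definition square_integrable_process ::
    "'w measure \<Rightarrow> (real \<Rightarrow> 'w \<Rightarrow> 'b :: {banach, second_countable_topology}) \<Rightarrow> bool"
where
  "square_integrable_process M Y \<longleftrightarrow>
     (\<forall>t\<ge>0. Y t \<in> borel_measurable M \<and> integrable M (\<lambda>\<omega>. (norm (Y t \<omega>))\<^sup>2))"

definition mean_zero_process ::
    "'w measure \<Rightarrow> (real \<Rightarrow> 'w \<Rightarrow> 'b :: {banach, second_countable_topology}) \<Rightarrow> bool"
where
  "mean_zero_process M Y \<longleftrightarrow>
     integrable_process M Y \<and> (\<forall>t\<ge>0. integral\<^sup>L M (Y t) = 0)"

definition zero_process :: "'w measure \<Rightarrow> (real \<Rightarrow> 'w \<Rightarrow> 'b :: zero) \<Rightarrow> bool" where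
  "zero_process M Y \<longleftrightarrow> (AE \<omega> in M. \<forall>t\<ge>0. Y t \<omega> = 0)"

text \<open>
  The sigma-algebra generated by a process.  Independence of processes is independence of these
  sigma-algebras; \<^const>\<open>prob_space.indep_var\<close> would force the processes to have the same value type.
\<close>

definition process_events ::
    "'w measure \<Rightarrow> (real \<Rightarrow> 'w \<Rightarrow> 'b :: topological_space) \<Rightarrow> 'w set set"
where
  "process_events M Y =
     sigma_sets (space M) {Y t -` A \<inter> space M | t A. 0 \<le> t \<and> A \<in> sets borel}"


section \<open>Product spaces and operators\<close>

text \<open>
  The separable Hilbert spaces \<open>H\<^sub>1, \<dots>, H\<^sub>d\<close> may differ from each other.  They are represented as
  closed subspaces \<open>Hs j\<close> of one separable Hilbert space \<open>'a\<close>; this is no restriction, since \<open>'a\<close>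
  can be taken to be their orthogonal direct sum.  The inner product of the type \<open>'a ^ 'd\<close> is the
  sum of the componentwise inner products, so their product \<open>H\<close> is the following closed subspace of
  \<open>'a ^ 'd\<close>, and the natural embedding of \<open>H\<^sub>j\<close> into \<open>H\<close> is \<^term>\<open>axis j\<close>.
\<close>

definition prod_space :: "('d \<Rightarrow> 'a set) \<Rightarrow> ('a ^ 'd) set" where
  "prod_space Hs = {u. \<forall>j. u $ j \<in> Hs j}"

definition joint_process :: "('d \<Rightarrow> real \<Rightarrow> 'w \<Rightarrow> 'a) \<Rightarrow> real \<Rightarrow> 'w \<Rightarrow> 'a ^ 'd" where
  "joint_process Ls t \<omega> = (\<chi> j. Ls j t \<omega>)"

definition multiparameter :: "('d \<Rightarrow> real \<Rightarrow> 'w \<Rightarrow> 'a) \<Rightarrow> real ^ 'd \<Rightarrow> 'w \<Rightarrow> 'a ^ 'd" where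
  "multiparameter Ls \<theta> \<omega> = (\<chi> j. Ls j (\<theta> $ j) \<omega>)"

definition subordinated ::
    "('d \<Rightarrow> real \<Rightarrow> 'w \<Rightarrow> 'a) \<Rightarrow> (real \<Rightarrow> 'w \<Rightarrow> real ^ 'd) \<Rightarrow> real \<Rightarrow> 'w \<Rightarrow> 'a ^ 'd"
where
  "subordinated Ls \<Theta> t \<omega> = multiparameter Ls (\<Theta> t \<omega>) \<omega>"

definition coord_scale :: "real ^ 'd \<Rightarrow> 'a :: real_vector ^ 'd \<Rightarrow> 'a ^ 'd" where
  "coord_scale a u = (\<chi> j. (a $ j) *\<^sub>R (u $ j))"

text \<open>
  For an operator \<open>T = T\<^sub>1 \<times> \<dots> \<times> T\<^sub>d\<close> acting coordinatewise this is
  \<open>a\<^sub>1 T\<^sub>1 \<times> \<dots> \<times> a\<^sub>d T\<^sub>d\<close>.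
\<close>

definition op_scale ::
    "real ^ 'd \<Rightarrow> ('a :: real_vector ^ 'd \<Rightarrow> 'a ^ 'd) \<Rightarrow> 'a ^ 'd \<Rightarrow> 'a ^ 'd"
where
  "op_scale a T = (\<lambda>u. coord_scale a (T u))"

definition tensor_op :: "'e :: real_inner \<Rightarrow> 'e \<Rightarrow> 'e \<Rightarrow> 'e" where
  "tensor_op x y = (\<lambda>z. (x \<bullet> z) *\<^sub>R y)"

definition cov_entry :: "'w measure \<Rightarrow> ('w \<Rightarrow> real ^ 'd) \<Rightarrow> 'd \<Rightarrow> 'd \<Rightarrow> real" where
  "cov_entry M Z i j =
     (\<integral>\<omega>. (Z \<omega> $ i - (\<integral>\<omega>'. Z \<omega>' $ i \<partial>M)) * (Z \<omega> $ j - (\<integral>\<omega>'. Z \<omega>' $ j \<partial>M)) \<partial>M)"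

text \<open>
  The covariance operator, on the closed subspace \<open>V\<close>, of a square integrable random variable with
  values in \<open>V\<close>; outside \<open>V\<close> it is \<^const>\<open>undefined\<close>.
\<close>

definition cov_op ::
    "'w measure \<Rightarrow> 'e :: {real_inner, banach, second_countable_topology} set \<Rightarrow> ('w \<Rightarrow> 'e) \<Rightarrow> 'e \<Rightarrow> 'e"
where
  "cov_op M V Y =
     (THE T. T \<in> V \<rightarrow>\<^sub>E V \<and>
        (\<forall>x\<in>V. \<forall>y\<in>V. T x \<bullet> y =
           (\<integral>\<omega>. ((Y \<omega> - integral\<^sup>L M Y) \<bullet> x) * ((Y \<omega> - integral\<^sup>L M Y) \<bullet> y) \<partial>M)))"

lemma closed_subspace_projection:
  fixes V :: "'e :: {real_inner, banach} set"
  assumes V: "subspace V" "closed V"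
  obtains p where "p \<in> V" "\<And>y. y \<in> V \<Longrightarrow> (x - p) \<bullet> y = 0"
proof -
  define d where "d = (INF v\<in>V. (norm (x - v))\<^sup>2)"
  have ne: "V \<noteq> {}" using V(1) subspace_0 by auto
  have bdd: "bdd_below ((\<lambda>v. (norm (x - v))\<^sup>2) ` V)" by (rule bdd_belowI[of _ 0]) auto
  have low: "d \<le> (norm (x - v))\<^sup>2" if "v \<in> V" for v
    unfolding d_def using bdd that by (rule cINF_lower)
  have "\<exists>v\<in>V. (norm (x - v))\<^sup>2 < d + 1 / Suc n" for n
    using cINF_less_iff[OF ne bdd, of "d + 1 / Suc n"] unfolding d_def by auto
  then obtain v where v: "\<And>n. v n \<in> V" "\<And>n. (norm (x - v n))\<^sup>2 < d + 1 / Suc n" by metis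
  have par: "(norm (v m - v n))\<^sup>2 \<le> 2 / Suc m + 2 / Suc n" for m n
  proof -
    have mid: "(1/2) *\<^sub>R (v m + v n) \<in> V" using V(1) v(1) by (intro subspace_scale subspace_add)
    let ?a = "x - v m" and ?b = "x - v n"
    have "(norm (?b - ?a))\<^sup>2 = 2 * (norm ?a)\<^sup>2 + 2 * (norm ?b)\<^sup>2 - (norm (?a + ?b))\<^sup>2"
      unfolding power2_norm_eq_inner inner_diff_left[of ?b] inner_diff_right[of _ ?b]
        inner_add_left[of ?a] inner_add_right[of _ ?a] inner_commute[of ?b ?a] by simp
    moreover have "?b - ?a = v m - v n" by simp
    moreover have "?a + ?b = 2 *\<^sub>R (x - (1/2) *\<^sub>R (v m + v n))"
      by (simp add: scaleR_diff_right scaleR_2)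
    ultimately have "(norm (v m - v n))\<^sup>2 = 2 * (norm ?a)\<^sup>2 + 2 * (norm ?b)\<^sup>2
        - 4 * (norm (x - (1/2) *\<^sub>R (v m + v n)))\<^sup>2"
      by (simp only: norm_scaleR power_mult_distrib) simp
    then show ?thesis using low[OF mid] v(2)[of m] v(2)[of n] by simp
  qed
  have "Cauchy v"
  proof (rule metric_CauchyI)
    fix e :: real assume e: "e > 0"
    obtain N :: nat where N: "4 / e\<^sup>2 < real N" using reals_Archimedean2 by blast
    have "dist (v m) (v n) < e" if "m \<ge> N" "n \<ge> N" for m n
    proof -
      have "2 / Suc m \<le> 2 / Suc N" "2 / Suc n \<le> 2 / Suc N"
        using that by (auto intro!: divide_left_mono)
      then have "(norm (v m - v n))\<^sup>2 \<le> 4 / Suc N" using par[of m n] by simp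
      also have "\<dots> < e\<^sup>2" using N e by (simp add: field_simps add_pos_pos add_strict_increasing)
      finally show ?thesis using e by (simp add: dist_norm power2_less_imp_less)
    qed
    then show "\<exists>M. \<forall>m\<ge>M. \<forall>n\<ge>M. dist (v m) (v n) < e" by blast
  qed
  then obtain p where p: "v \<longlonglongrightarrow> p" using Cauchy_convergent convergent_def by blast
  have pV: "p \<in> V" using closed_sequentially[OF V(2) v(1) p] .
  have pd: "(norm (x - p))\<^sup>2 \<le> d"
  proof (rule LIMSEQ_le)
    show "(\<lambda>n. (norm (x - v n))\<^sup>2) \<longlonglongrightarrow> (norm (x - p))\<^sup>2" by (intro tendsto_intros p)
    have "(\<lambda>n. d + inverse (real (Suc n))) \<longlonglongrightarrow> d + 0"
      by (intro tendsto_intros LIMSEQ_inverse_real_of_nat)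
    then show "(\<lambda>n. d + 1 / Suc n) \<longlonglongrightarrow> d" by (simp add: inverse_eq_divide)
    show "\<exists>N. \<forall>n\<ge>N. (norm (x - v n))\<^sup>2 \<le> d + 1 / Suc n" using v(2) less_imp_le by blast
  qed
  have "(x - p) \<bullet> y = 0" if y: "y \<in> V" for y
  proof (cases "y = 0")
    case False
    define c where "c = ((x - p) \<bullet> y) / (y \<bullet> y)"
    have pc: "p + c *\<^sub>R y \<in> V" using V(1) pV y by (intro subspace_add subspace_scale)
    have "(norm (x - p))\<^sup>2 \<le> (norm (x - (p + c *\<^sub>R y)))\<^sup>2" using low[OF pc] pd by (rule order_trans[rotated])
    also have "\<dots> = (norm ((x - p) - c *\<^sub>R y))\<^sup>2" by (simp add: algebra_simps)
    also have "\<dots> = (norm (x - p))\<^sup>2 - 2 * c * ((x - p) \<bullet> y) + c\<^sup>2 * (y \<bullet> y)"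
      unfolding power2_norm_eq_inner inner_diff_left[of "x - p"] inner_diff_right[of _ "x - p"]
        inner_scaleR_left inner_scaleR_right inner_commute[of y "x - p"]
      by (simp add: power2_eq_square right_diff_distrib)
    also have "\<dots> = (norm (x - p))\<^sup>2 - ((x - p) \<bullet> y)\<^sup>2 / (y \<bullet> y)"
      using False by (simp add: c_def power2_eq_square field_simps)
    finally have "((x - p) \<bullet> y)\<^sup>2 / (y \<bullet> y) \<le> 0" by simp
    moreover have "y \<bullet> y > 0" using False by simp
    ultimately have "((x - p) \<bullet> y)\<^sup>2 \<le> 0" by (simp add: divide_le_0_iff)
    then show ?thesis by simp
  qed simp
  then show ?thesis using pV that by blast
qed

lemma integral_in_closed_subspace:
  fixes V :: "'e :: {real_inner, banach, second_countable_topology} set"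
  assumes V: "subspace V" "closed V"
    and Z: "integrable M Z" "\<And>\<omega>. \<omega> \<in> space M \<Longrightarrow> Z \<omega> \<in> V"
  shows "integral\<^sup>L M Z \<in> V"
proof -
  obtain p where p: "p \<in> V" "\<And>y. y \<in> V \<Longrightarrow> (integral\<^sup>L M Z - p) \<bullet> y = 0"
    using closed_subspace_projection[OF V] by metis
  define w where "w = integral\<^sup>L M Z - p"
  have "w \<bullet> integral\<^sup>L M Z = (\<integral>\<omega>. w \<bullet> Z \<omega> \<partial>M)"
    using Z(1) by simp
  also have "\<dots> = (\<integral>\<omega>. 0 \<partial>M)"
    using p(2) Z(2) by (intro Bochner_Integration.integral_cong) (auto simp: w_def)
  finally have "w \<bullet> w = 0" using p(2)[OF p(1)] by (simp add: w_def inner_diff_right)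
  then show ?thesis using p(1) by (simp add: w_def)
qed

text \<open>The description in the definition of \<^const>\<open>cov_op\<close> does determine a unique operator.\<close>

lemma cov_op_exists_unique:
  fixes V :: "'e :: {real_inner, banach, second_countable_topology} set"
  assumes M: "prob_space M" and V: "subspace V" "closed V"
    and Y: "Y \<in> borel_measurable M" "integrable M (\<lambda>\<omega>. (norm (Y \<omega>))\<^sup>2)"
    and YV: "\<And>\<omega>. \<omega> \<in> space M \<Longrightarrow> Y \<omega> \<in> V"
  shows "\<exists>!T. T \<in> V \<rightarrow>\<^sub>E V \<and>
        (\<forall>x\<in>V. \<forall>y\<in>V. T x \<bullet> y =
           (\<integral>\<omega>. ((Y \<omega> - integral\<^sup>L M Y) \<bullet> x) * ((Y \<omega> - integral\<^sup>L M Y) \<bullet> y) \<partial>M))"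
proof -
  interpret prob_space M by fact
  define Z where "Z \<omega> = Y \<omega> - integral\<^sup>L M Y" for \<omega>
  have "(\<lambda>\<omega>. Y \<omega> - integral\<^sup>L M Y) \<in> borel_measurable M"
    by (intro borel_measurable_diff Y(1) borel_measurable_const)
  then have Zm [measurable]: "Z \<in> borel_measurable M" by (simp add: Z_def[abs_def])
  have "integrable M (\<lambda>\<omega>. norm (Y \<omega>))"
    by (rule square_integrable_imp_integrable[OF measurable_compose[OF Y(1) borel_measurable_norm] Y(2)])
  then have iY: "integrable M Y" using integrable_norm_iff[OF Y(1)] by blast
  have EYV: "integral\<^sup>L M Y \<in> V" by (rule integral_in_closed_subspace[OF V iY YV])
  have ZV: "Z \<omega> \<in> V" if "\<omega> \<in> space M" for \<omega>
    using V(1) YV[OF that] EYV unfolding Z_def by (rule subspace_diff)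
  have Z2: "integrable M (\<lambda>\<omega>. (norm (Z \<omega>))\<^sup>2)"
  proof (rule Bochner_Integration.integrable_bound)
    show "integrable M (\<lambda>\<omega>. 2 * (norm (Y \<omega>))\<^sup>2 + 2 * (norm (integral\<^sup>L M Y))\<^sup>2)"
      using Y(2) by simp
    have "(norm (a - b))\<^sup>2 \<le> 2 * (norm a)\<^sup>2 + 2 * (norm b)\<^sup>2" for a b :: 'e
    proof -
      have "(norm (a - b))\<^sup>2 \<le> (norm a + norm b)\<^sup>2"
        by (intro power_mono norm_triangle_ineq4) simp
      also have "\<dots> \<le> 2 * (norm a)\<^sup>2 + 2 * (norm b)\<^sup>2"
        using sum_squares_bound[of "norm a" "norm b"] by (simp add: power2_sum)
      finally show ?thesis .
    qed
    then show "AE \<omega> in M. norm ((norm (Z \<omega>))\<^sup>2)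
        \<le> norm (2 * (norm (Y \<omega>))\<^sup>2 + 2 * (norm (integral\<^sup>L M Y))\<^sup>2)"
      unfolding Z_def by simp
  qed measurable
  have iZ: "integrable M (\<lambda>\<omega>. (Z \<omega> \<bullet> x) *\<^sub>R Z \<omega>)" for x
  proof (rule Bochner_Integration.integrable_bound)
    show "integrable M (\<lambda>\<omega>. norm x * (norm (Z \<omega>))\<^sup>2)" using Z2 by simp
    have "norm ((z \<bullet> x) *\<^sub>R z) \<le> norm (norm x * (norm z)\<^sup>2)" for z
      using mult_right_mono[OF Cauchy_Schwarz_ineq2[of z x], of "norm z"]
      by (simp add: power2_eq_square mult_ac)
    then show "AE \<omega> in M. norm ((Z \<omega> \<bullet> x) *\<^sub>R Z \<omega>) \<le> norm (norm x * (norm (Z \<omega>))\<^sup>2)"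
      by simp
  qed measurable
  define T where "T = (\<lambda>x\<in>V. \<integral>\<omega>. (Z \<omega> \<bullet> x) *\<^sub>R Z \<omega> \<partial>M)"
  show ?thesis
    unfolding Z_def[symmetric]
  proof (rule ex1I)
    have "(\<integral>\<omega>. (Z \<omega> \<bullet> x) *\<^sub>R Z \<omega> \<partial>M) \<in> V" for x
      using integral_in_closed_subspace[OF V iZ] V(1) ZV by (simp add: subspace_scale)
    moreover have "(\<integral>\<omega>. (Z \<omega> \<bullet> x) *\<^sub>R Z \<omega> \<partial>M) \<bullet> y = (\<integral>\<omega>. (Z \<omega> \<bullet> x) * (Z \<omega> \<bullet> y) \<partial>M)" for x y
      using integral_inner_left[of y M "\<lambda>\<omega>. (Z \<omega> \<bullet> x) *\<^sub>R Z \<omega>"] iZ by simp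
    ultimately show "T \<in> V \<rightarrow>\<^sub>E V \<and>
        (\<forall>x\<in>V. \<forall>y\<in>V. T x \<bullet> y = (\<integral>\<omega>. (Z \<omega> \<bullet> x) * (Z \<omega> \<bullet> y) \<partial>M))"
      unfolding T_def by auto
  next
    fix S assume S: "S \<in> V \<rightarrow>\<^sub>E V \<and>
        (\<forall>x\<in>V. \<forall>y\<in>V. S x \<bullet> y = (\<integral>\<omega>. (Z \<omega> \<bullet> x) * (Z \<omega> \<bullet> y) \<partial>M))"
    have TV: "T \<in> V \<rightarrow>\<^sub>E V"
      using integral_in_closed_subspace[OF V iZ] V(1) ZV by (auto simp: T_def subspace_scale)
    have TI: "T x \<bullet> y = (\<integral>\<omega>. (Z \<omega> \<bullet> x) * (Z \<omega> \<bullet> y) \<partial>M)" if "x \<in> V" for x y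
      using integral_inner_left[of y M "\<lambda>\<omega>. (Z \<omega> \<bullet> x) *\<^sub>R Z \<omega>"] iZ that by (simp add: T_def)
    show "S = T"
    proof (rule PiE_ext)
      show "S \<in> V \<rightarrow>\<^sub>E V" using S by blast
      show "T \<in> V \<rightarrow>\<^sub>E V" by (rule TV)
      fix x assume x: "x \<in> V"
      have "S x - T x \<in> V" using S TV x V(1) by (intro subspace_diff) (auto simp: PiE_iff)
      then have "(S x - T x) \<bullet> (S x - T x) = 0"
        using S TI[OF x] x by (simp add: inner_diff_left)
      then show "S x = T x" by simp
    qed
  qed
qed

end

theory Submission
  imports Defs
begin

text \<open>
  Freezing the time change is the key step.  Since \<open>\<Theta>\<close> and \<open>L\<close> are independent, Fubini's theorem
  turns every moment of \<open>X(t) = L(\<Theta>(t))\<close> into an iterated integral, in which the moment of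
  \<open>L(\<theta>)\<close> at a deterministic time is evaluated first and then averaged over \<open>\<theta> = \<Theta>(t)\<close>.  The
  two copies of the sample space that this needs carry the \<open>\<sigma>\<close>-algebras generated by \<open>\<Theta>\<close> and by
  \<open>L\<close>, and right-continuity of the paths makes \<open>(\<omega>', \<omega>) \<mapsto> L\<^sub>j(\<Theta>\<^sub>j(t)(\<omega>'))(\<omega>)\<close> jointly measurable
  (\<open>right_continuous_random_time_measurable\<close>, \<open>indep_var_integral\<close>).

  The moments at deterministic times come from stationary and independent increments: if \<open>L\<^sub>j\<close> is square
  integrable with mean \<open>m\<close> at time 1, then for every bounded bilinear form \<open>b\<close>
  \<open>E b(L\<^sub>j(s), L\<^sub>j(s)) = s\<^sup>2 b(m, m) + s (E b(L\<^sub>j(1), L\<^sub>j(1)) - b(m, m))\<close>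
  (\<open>levy_second_moment\<close>).  The mean and the covariance form are additive in \<open>s\<close>, and they vanish as
  \<open>s\<close> tends to 0, hence they are linear.  With the inner product for \<open>b\<close> and with \<open>c\<close> the variance of
  \<open>L\<^sub>j(1)\<close>, freezing the time change yields
  \<open>E |X\<^sub>j(t)|\<^sup>2 = E (\<Theta>\<^sub>j(t)\<^sup>2 |m|\<^sup>2 + \<Theta>\<^sub>j(t) c)\<close>,
  where both terms are nonnegative (\<open>X_square_integrable_iff\<close>).  All four alternatives can be read off
  here: \<open>m \<noteq> 0\<close> forces \<open>\<Theta>\<^sub>j\<close> to be square integrable, \<open>m = 0 \<noteq> c\<close> forces it to be integrable, and
  \<open>m = c = 0\<close> makes \<open>L\<^sub>j\<close> vanish.  That \<open>L\<^sub>j\<close> is square integrable at all, unless \<open>\<Theta>\<^sub>j = 0\<close>, holds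
  because the inner integral is finite for some value \<open>s > 0\<close> of \<open>\<Theta>\<^sub>j(t)\<close>, and square integrability at
  one positive time spreads to all times (\<open>levy_square_integrable_all_times\<close>).

  The covariance operator is determined by its matrix elements, which split into the forms
  \<open>b(u, v) = \<langle>u | x\<^sub>i\<rangle> \<langle>v | y\<^sub>j\<rangle>\<close>.  For \<open>i \<noteq> j\<close> the independence of \<open>L\<^sub>i\<close> and \<open>L\<^sub>j\<close> replaces the
  linear term above by 0.  Subtracting the product of the means leaves the covariance of \<open>\<Theta>\<^sub>i(1)\<close> and
  \<open>\<Theta>\<^sub>j(1)\<close> times \<open>b(m\<^sub>i, m\<^sub>j)\<close>, plus the mean of \<open>\<Theta>\<^sub>j(1)\<close> times the covariance form of \<open>L(1)\<close>
  (\<open>X_covariance_entry\<close>, \<open>subordinated_covariance\<close>).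
\<close>

section \<open>Square integrable random variables and independence\<close>

definition square_integrable ::
    "'w measure \<Rightarrow> ('w \<Rightarrow> 'b :: {banach, second_countable_topology}) \<Rightarrow> bool"
where
  "square_integrable M X \<longleftrightarrow> X \<in> borel_measurable M \<and> integrable M (\<lambda>\<omega>. (norm (X \<omega>))\<^sup>2)"

text \<open>
  Bilinear forms stand in for three things at once: the squared norm, the product of real variables,
  and the matrix elements \<open>(u, v) \<mapsto> \<langle>u | x\<rangle> \<langle>v | y\<rangle>\<close> of a covariance operator.
\<close>

lemma square_integrable_bilinear:
  fixes b :: "'b :: {banach, second_countable_topology} \<Rightarrow> 'b \<Rightarrow> real"
  assumes b: "bounded_bilinear b" and X: "square_integrable M X" and Y: "square_integrable M Y"
  shows "integrable M (\<lambda>\<omega>. b (X \<omega>) (Y \<omega>))"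
proof -
  obtain K where K: "K \<ge> 0" "\<And>u v. norm (b u v) \<le> norm u * norm v * K"
    using bounded_bilinear.nonneg_bounded[OF b] by blast
  have m: "X \<in> borel_measurable M" "Y \<in> borel_measurable M"
    using X Y by (auto simp: square_integrable_def)
  have "continuous_on UNIV (\<lambda>z. b (fst z) (snd z))"
    by (rule bounded_bilinear.continuous_on[OF b]) (auto intro!: continuous_intros)
  then have bm: "(\<lambda>\<omega>. b (X \<omega>) (Y \<omega>)) \<in> borel_measurable M"
    using borel_measurable_continuous_Pair[OF m, of b] by simp
  show ?thesis
  proof (rule Bochner_Integration.integrable_bound[OF _ bm])
    show "integrable M (\<lambda>\<omega>. K * ((norm (X \<omega>))\<^sup>2 + (norm (Y \<omega>))\<^sup>2))"
      using X Y by (auto simp: square_integrable_def)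
    have "norm (b u v) \<le> norm (K * ((norm u)\<^sup>2 + (norm v)\<^sup>2))" for u v
    proof -
      have "2 * (norm u * norm v) \<le> (norm u)\<^sup>2 + (norm v)\<^sup>2"
        using sum_squares_bound[of "norm u" "norm v"] by simp
      then have "norm u * norm v \<le> (norm u)\<^sup>2 + (norm v)\<^sup>2"
        using mult_nonneg_nonneg[OF norm_ge_zero[of u] norm_ge_zero[of v]] by linarith
      then have "norm u * norm v * K \<le> ((norm u)\<^sup>2 + (norm v)\<^sup>2) * K"
        using K(1) by (rule mult_right_mono)
      then have "norm (b u v) \<le> K * ((norm u)\<^sup>2 + (norm v)\<^sup>2)"
        using K(2)[of u v] by (simp only: mult.commute)
      then show ?thesis by (simp only: real_norm_def)
    qed
    then show "AE \<omega> in M. norm (b (X \<omega>) (Y \<omega>)) \<le> norm (K * ((norm (X \<omega>))\<^sup>2 + (norm (Y \<omega>))\<^sup>2))"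
      by simp
  qed
qed

lemma norm_add_square_le: "(norm (u + v :: 'b :: real_normed_vector))\<^sup>2 \<le> 2 * (norm u)\<^sup>2 + 2 * (norm v)\<^sup>2"
proof -
  have "(norm (u + v))\<^sup>2 \<le> (norm u + norm v)\<^sup>2"
    by (intro power_mono norm_triangle_ineq) simp
  also have "\<dots> \<le> 2 * (norm u)\<^sup>2 + 2 * (norm v)\<^sup>2"
    using sum_squares_bound[of "norm u" "norm v"] by (simp add: power2_sum)
  finally show ?thesis .
qed

lemma square_integrable_add:
  assumes "square_integrable M X" "square_integrable M Y"
  shows "square_integrable M (\<lambda>\<omega>. X \<omega> + Y \<omega>)"
  unfolding square_integrable_def
proof
  show m: "(\<lambda>\<omega>. X \<omega> + Y \<omega>) \<in> borel_measurable M"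
    using assms by (auto simp: square_integrable_def)
  show "integrable M (\<lambda>\<omega>. (norm (X \<omega> + Y \<omega>))\<^sup>2)"
  proof (rule Bochner_Integration.integrable_bound)
    show "integrable M (\<lambda>\<omega>. 2 * (norm (X \<omega>))\<^sup>2 + 2 * (norm (Y \<omega>))\<^sup>2)"
      using assms by (auto simp: square_integrable_def)
  qed (use m norm_add_square_le in auto)
qed

context prob_space
begin

lemma square_integrable_const: "square_integrable M (\<lambda>\<omega>. c)"
  by (simp add: square_integrable_def)

lemma square_integrable_diff_const:
  "square_integrable M X \<Longrightarrow> square_integrable M (\<lambda>\<omega>. X \<omega> - c)"
  using square_integrable_add[OF _ square_integrable_const, of X "- c"] by simp

lemma square_integrable_integrable:
  assumes "square_integrable M X" shows "integrable M X"
proof -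
  have X: "X \<in> borel_measurable M" "integrable M (\<lambda>\<omega>. (norm (X \<omega>))\<^sup>2)"
    using assms by (auto simp: square_integrable_def)
  have "integrable M (\<lambda>\<omega>. norm (X \<omega>))"
    by (rule square_integrable_imp_integrable[OF measurable_compose[OF X(1) borel_measurable_norm] X(2)])
  then show ?thesis using integrable_norm_iff[OF X(1)] by blast
qed

text \<open>
  The joint law of independent variables is the product of their laws, so the expectation may be taken
  over two independent copies \<open>\<omega>'\<close> and \<open>\<omega>\<close> of the sample point.
\<close>

lemma indep_var_nn_integral:
  assumes XY: "indep_var S X T Y" and f: "f \<in> borel_measurable (S \<Otimes>\<^sub>M T)"
  shows "(\<integral>\<^sup>+\<omega>. f (X \<omega>, Y \<omega>) \<partial>M) = (\<integral>\<^sup>+\<omega>'. \<integral>\<^sup>+\<omega>. f (X \<omega>', Y \<omega>) \<partial>M \<partial>M)"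
proof -
  have X: "random_variable S X" and Y: "random_variable T Y"
    using indep_var_rv1[OF XY] indep_var_rv2[OF XY] by blast+
  have P: "(\<lambda>\<omega>. (X \<omega>, Y \<omega>)) \<in> measurable M (S \<Otimes>\<^sub>M T)" using X Y by (rule measurable_Pair)
  have eq: "distr M (S \<Otimes>\<^sub>M T) (\<lambda>\<omega>. (X \<omega>, Y \<omega>)) = distr M S X \<Otimes>\<^sub>M distr M T Y"
    using XY[unfolded indep_var_distribution_eq] by (elim conjE) (rule sym)
  interpret Q: prob_space "distr M T Y" by (rule prob_space_distr) (rule Y)
  have f': "f \<in> borel_measurable (distr M S X \<Otimes>\<^sub>M distr M T Y)"
    using f by (simp cong: measurable_cong_sets)
  have "(\<integral>\<^sup>+\<omega>. f (X \<omega>, Y \<omega>) \<partial>M) = (\<integral>\<^sup>+z. f z \<partial>distr M (S \<Otimes>\<^sub>M T) (\<lambda>\<omega>. (X \<omega>, Y \<omega>)))"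
    by (rule nn_integral_distr[symmetric, OF P]) (simp add: f)
  also have "\<dots> = (\<integral>\<^sup>+x. \<integral>\<^sup>+y. f (x, y) \<partial>distr M T Y \<partial>distr M S X)"
    unfolding eq by (rule Q.nn_integral_fst[symmetric, OF f'])
  also have "\<dots> = (\<integral>\<^sup>+\<omega>'. \<integral>\<^sup>+y. f (X \<omega>', y) \<partial>distr M T Y \<partial>M)"
    by (rule nn_integral_distr[OF X]) (use Q.borel_measurable_nn_integral_fst[OF f'] in simp)
  also have "\<dots> = (\<integral>\<^sup>+\<omega>'. \<integral>\<^sup>+\<omega>. f (X \<omega>', Y \<omega>) \<partial>M \<partial>M)"
    by (intro nn_integral_cong nn_integral_distr[OF Y] measurable_compose[OF measurable_Pair1'[OF measurable_space[OF X]] f])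
      (auto intro!: measurable_compose[OF measurable_Pair1'[OF measurable_space[OF X]] f])
  finally show ?thesis .
qed

lemma indep_var_integral:
  fixes f :: "_ \<Rightarrow> 'e :: {banach, second_countable_topology}"
  assumes XY: "indep_var S X T Y" and f: "f \<in> borel_measurable (S \<Otimes>\<^sub>M T)"
    and i: "integrable M (\<lambda>\<omega>. f (X \<omega>, Y \<omega>))"
  shows "(\<integral>\<omega>. f (X \<omega>, Y \<omega>) \<partial>M) = (\<integral>\<omega>'. \<integral>\<omega>. f (X \<omega>', Y \<omega>) \<partial>M \<partial>M)"
proof -
  have X: "random_variable S X" and Y: "random_variable T Y"
    using indep_var_rv1[OF XY] indep_var_rv2[OF XY] by blast+
  have P: "(\<lambda>\<omega>. (X \<omega>, Y \<omega>)) \<in> measurable M (S \<Otimes>\<^sub>M T)" using X Y by (rule measurable_Pair)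
  have eq: "distr M (S \<Otimes>\<^sub>M T) (\<lambda>\<omega>. (X \<omega>, Y \<omega>)) = distr M S X \<Otimes>\<^sub>M distr M T Y"
    using XY[unfolded indep_var_distribution_eq] by (elim conjE) (rule sym)
  interpret P: prob_space "distr M S X" by (rule prob_space_distr) (rule X)
  interpret Q: prob_space "distr M T Y" by (rule prob_space_distr) (rule Y)
  interpret PQ: pair_prob_space "distr M S X" "distr M T Y" ..
  have f': "f \<in> borel_measurable (distr M S X \<Otimes>\<^sub>M distr M T Y)"
    using f by (simp cong: measurable_cong_sets)
  have i': "integrable (distr M S X \<Otimes>\<^sub>M distr M T Y) f"
    using i integrable_distr_eq[OF P f] by (simp only: eq)
  have "(\<integral>\<omega>. f (X \<omega>, Y \<omega>) \<partial>M) = (\<integral>z. f z \<partial>distr M (S \<Otimes>\<^sub>M T) (\<lambda>\<omega>. (X \<omega>, Y \<omega>)))"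
    by (rule integral_distr[symmetric, OF P f])
  also have "\<dots> = (\<integral>x. \<integral>y. f (x, y) \<partial>distr M T Y \<partial>distr M S X)"
    unfolding eq by (rule PQ.integral_fst'[symmetric, OF i'])
  also have "\<dots> = (\<integral>\<omega>'. \<integral>y. f (X \<omega>', y) \<partial>distr M T Y \<partial>M)"
    by (rule integral_distr[OF X]) (use Q.borel_measurable_lebesgue_integral[of "\<lambda>x y. f (x, y)" "distr M S X"] f' in simp)
  also have "\<dots> = (\<integral>\<omega>'. \<integral>\<omega>. f (X \<omega>', Y \<omega>) \<partial>M \<partial>M)"
    by (intro Bochner_Integration.integral_cong refl integral_distr[OF Y] 
        measurable_compose[OF measurable_Pair1'[OF measurable_space[OF X]] f])
  finally show ?thesis .
qed

lemma indep_var_bilinear_expectation: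
  fixes b :: "'b :: {banach, second_countable_topology} \<Rightarrow> 'b \<Rightarrow> real"
  assumes b: "bounded_bilinear b"
    and X: "square_integrable M X" and Y: "square_integrable M Y" and XY: "indep_var borel X borel Y"
  shows "(\<integral>\<omega>. b (X \<omega>) (Y \<omega>) \<partial>M) = b (integral\<^sup>L M X) (integral\<^sup>L M Y)"
proof -
  have c: "continuous_on UNIV (\<lambda>z. b (fst z) (snd z))"
    by (rule bounded_bilinear.continuous_on[OF b]) (auto intro!: continuous_intros)
  have f: "(\<lambda>z. b (fst z) (snd z)) \<in> borel_measurable (borel \<Otimes>\<^sub>M borel)"
    using borel_measurable_continuous_onI[OF c] by (simp add: borel_prod)
  have "(\<integral>\<omega>. b (X \<omega>) (Y \<omega>) \<partial>M) = (\<integral>\<omega>'. \<integral>\<omega>. b (X \<omega>') (Y \<omega>) \<partial>M \<partial>M)"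
    using indep_var_integral[OF XY f] square_integrable_bilinear[OF b X Y] by (simp only: fst_conv snd_conv)
  also have "\<dots> = (\<integral>\<omega>'. b (X \<omega>') (integral\<^sup>L M Y) \<partial>M)"
    using integral_bounded_linear[OF bounded_bilinear.bounded_linear_right[OF b]
        square_integrable_integrable[OF Y]] by (simp only:)
  also have "\<dots> = b (integral\<^sup>L M X) (integral\<^sup>L M Y)"
    using integral_bounded_linear[OF bounded_bilinear.bounded_linear_left[OF b]
        square_integrable_integrable[OF X]] by (simp only:)
  finally show ?thesis .
qed

lemma indep_set_commute: "indep_set A B \<Longrightarrow> indep_set B A"
  unfolding indep_sets2_eq by (metis Int_commute mult.commute)

lemma indep_var_commute: "indep_var S X T Y \<Longrightarrow> indep_var T Y S X"
  unfolding indep_var_eq using indep_set_commute by blast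

text \<open>By Fubini, for some value \<open>y\<close> of \<open>Y\<close> the translate \<open>X + y\<close> is square integrable.\<close>

lemma indep_var_square_integrable_summand:
  fixes X :: "'a \<Rightarrow> 'b :: {banach, second_countable_topology}"
  assumes XY: "indep_var borel X borel Y" and s: "square_integrable M (\<lambda>\<omega>. X \<omega> + Y \<omega>)"
  shows "square_integrable M X"
proof -
  have f: "(\<lambda>z. ennreal ((norm (snd z + fst z :: 'b))\<^sup>2)) \<in> borel_measurable (borel \<Otimes>\<^sub>M borel)"
    by measurable
  have YX: "indep_var borel Y borel X"
    using XY by (rule indep_var_commute)
  have X [measurable]: "X \<in> borel_measurable M" using indep_var_rv1[OF XY] .
  have Y [measurable]: "Y \<in> borel_measurable M" using indep_var_rv2[OF XY] .
  have "(\<integral>\<^sup>+\<omega>. (norm (X \<omega> + Y \<omega>))\<^sup>2 \<partial>M) < \<infinity>"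
    using s by (simp add: square_integrable_def integrable_iff_bounded)
  then have "(\<integral>\<^sup>+\<omega>'. \<integral>\<^sup>+\<omega>. (norm (X \<omega> + Y \<omega>'))\<^sup>2 \<partial>M \<partial>M) \<noteq> \<infinity>"
    using indep_var_nn_integral[OF YX f] by simp
  then have "AE \<omega>' in M. (\<integral>\<^sup>+\<omega>. (norm (X \<omega> + Y \<omega>'))\<^sup>2 \<partial>M) \<noteq> \<infinity>"
    by (rule nn_integral_PInf_AE[rotated]) measurable
  moreover have "\<not> (AE \<omega> in M. False)" by simp
  ultimately have "\<exists>\<omega>'. (\<integral>\<^sup>+\<omega>. (norm (X \<omega> + Y \<omega>'))\<^sup>2 \<partial>M) \<noteq> \<infinity>"
    using eventually_mono[of _ "ae_filter M" "\<lambda>_. False"] by blast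
  then obtain y where "(\<integral>\<^sup>+\<omega>. (norm (X \<omega> + y))\<^sup>2 \<partial>M) \<noteq> \<infinity>"
    by blast
  then have "square_integrable M (\<lambda>\<omega>. X \<omega> + y)"
    by (simp add: square_integrable_def integrable_iff_bounded less_top)
  from square_integrable_diff_const[OF this, of y] show ?thesis by simp
qed

end

section \<open>Additive functions on the half-line\<close>

text \<open>
  The difference \<open>h\<close> of \<open>g\<close> and the linear function with the same value at 1 is additive and vanishes at
  all nonnegative rationals.  Hence \<open>h s\<close> is equal to the value of \<open>h\<close> at the small remainder of \<open>s\<close>
  after a rational is taken away, and this is close to 0.
\<close>

lemma additive_tendsto_0_imp_linear:
  fixes g :: "real \<Rightarrow> 'b :: real_normed_vector"
  assumes add: "\<And>s t. 0 \<le> s \<Longrightarrow> 0 \<le> t \<Longrightarrow> g (s + t) = g s + g t"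
    and lim: "(g \<longlongrightarrow> 0) (at_right 0)" and s: "0 \<le> s"
  shows "g s = s *\<^sub>R g 1"
proof -
  define h where "h r = g r - r *\<^sub>R g 1" for r
  have hadd: "h (s + t) = h s + h t" if "0 \<le> s" "0 \<le> t" for s t
    using add[OF that] by (simp add: h_def algebra_simps)
  have h0: "h 0 = 0" using hadd[of 0 0] by simp
  have hmult: "h (real n * r) = real n *\<^sub>R h r" if "0 \<le> r" for n r
  proof (induction n)
    case (Suc n)
    have "h (real (Suc n) * r) = h (real n * r + r)" by (simp add: algebra_simps)
    also have "\<dots> = real (Suc n) *\<^sub>R h r"
      using hadd[of "real n * r" r] that Suc by (simp add: algebra_simps)
    finally show ?case .
  qed (simp add: h0)
  have h1: "h 1 = 0" by (simp add: h_def)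
  have hrat: "h (real k / real n) = 0" if "n > 0" for k n
  proof -
    have "real n *\<^sub>R h (1 / real n) = 0" using hmult[of "1 / real n" n] that h1 by simp
    then have "h (1 / real n) = 0" using that by simp
    then show ?thesis using hmult[of "1 / real n" k] by simp
  qed
  have hlim: "(h \<longlongrightarrow> 0) (at_right 0)"
    unfolding h_def by (rule tendsto_eq_intros lim | simp)+
  have "norm (h s) < e" if e: "e > 0" for e
  proof -
    obtain \<delta> where \<delta>: "\<delta> > 0" "\<And>r. 0 < r \<Longrightarrow> r < \<delta> \<Longrightarrow> norm (h r) < e"
      using tendstoD[OF hlim e] by (auto simp: eventually_at_right_field)
    obtain n :: nat where n: "n > 0" "1 / real n < \<delta>"
      using \<delta>(1) by (metis nat_approx_posE of_nat_Suc zero_less_Suc)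
    define k where "k = nat \<lfloor>real n * s\<rfloor>"
    have k: "real k \<le> real n * s" "real n * s < real k + 1"
      using s by (auto simp: k_def)
    define r where "r = s - real k / real n"
    have "real n * r = real n * s - real k" using n(1) by (simp add: r_def right_diff_distrib)
    then have "0 \<le> real n * r" "real n * r < 1" using k by linarith+
    then have r: "0 \<le> r" "r < 1 / real n" using n(1) by (auto simp: zero_le_mult_iff field_simps)
    have "h s = h (real k / real n + r)" by (simp add: r_def)
    also have "\<dots> = h r" using hadd[of "real k / real n" r] r hrat[OF n(1)] by simp
    finally show ?thesis using r n(2) \<delta> h0 e by (cases "r = 0") auto
  qed
  then have "h s = 0" by (metis norm_le_zero_iff not_less order_less_irrefl)
  then show ?thesis by (simp add: h_def)
qed

text \<open>
  Such a function is nondecreasing, so on \<open>[0, 1/n]\<close> it is bounded by \<open>g (1/n) = g 1 / n\<close>.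
\<close>

lemma additive_nonneg_tendsto_0:
  fixes g :: "real \<Rightarrow> real"
  assumes add: "\<And>s t. 0 \<le> s \<Longrightarrow> 0 \<le> t \<Longrightarrow> g (s + t) = g s + g t"
    and nonneg: "\<And>s. 0 \<le> s \<Longrightarrow> 0 \<le> g s"
  shows "(g \<longlongrightarrow> 0) (at_right 0)"
proof (rule tendstoI)
  fix e :: real assume e: "e > 0"
  have g0: "g 0 = 0" using add[of 0 0] by simp
  have mult: "g (real n * r) = real n * g r" if "0 \<le> r" for n r
  proof (induction n)
    case (Suc n)
    have "g (real (Suc n) * r) = g (real n * r + r)" by (simp add: algebra_simps)
    also have "\<dots> = real (Suc n) * g r"
      using add[of "real n * r" r] that Suc by (simp add: algebra_simps)
    finally show ?case .
  qed (simp add: g0)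
  obtain n :: nat where n: "g 1 < real n * e" using reals_Archimedean3[OF e] by blast
  have n0: "n > 0" using n nonneg[of 1] by (cases n) auto
  have "g r < e" if r: "0 < r" "r < 1 / real n" for r
  proof -
    have "real n * g r = g (real n * r)" using mult[of r n] r by simp
    also have "\<dots> \<le> g (real n * r + (1 - real n * r))"
      using add[of "real n * r" "1 - real n * r"] nonneg[of "1 - real n * r"] r n0
      by (simp add: field_simps)
    also have "\<dots> < real n * e" using n by simp
    finally show ?thesis using n0 by simp
  qed
  then show "\<forall>\<^sub>F r in at_right 0. dist (g r) 0 < e"
    unfolding eventually_at_right_field dist_real_def
    using n0 nonneg by (intro exI[of _ "1 / real n"]) (auto simp: abs_of_nonneg)
qed

section \<open>Moments of Levy processes\<close>

context prob_space
begin

lemma square_integrable_cong_distr: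
  assumes d: "distr M borel X = distr M borel Y"
    and m: "X \<in> borel_measurable M" "Y \<in> borel_measurable M" and X: "square_integrable M X"
  shows "square_integrable M Y"
proof -
  have "integrable (distr M borel X) (\<lambda>x. (norm x)\<^sup>2)"
    using X by (subst integrable_distr_eq[OF m(1)]) (auto simp: square_integrable_def)
  then have "integrable M (\<lambda>\<omega>. (norm (Y \<omega>))\<^sup>2)"
    unfolding d by (subst (asm) integrable_distr_eq[OF m(2)]) auto
  then show ?thesis using m by (simp add: square_integrable_def)
qed

lemma expectation_cong_distr:
  fixes f :: "'b :: topological_space \<Rightarrow> 'e :: {banach, second_countable_topology}"
  assumes d: "distr M borel X = distr M borel Y"
    and m: "X \<in> borel_measurable M" "Y \<in> borel_measurable M" and f: "f \<in> borel_measurable borel"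
  shows "(\<integral>\<omega>. f (X \<omega>) \<partial>M) = (\<integral>\<omega>. f (Y \<omega>) \<partial>M)"
  using integral_distr[OF m(1) f] integral_distr[OF m(2) f] d by (simp only:)

lemma levy_process_measurable:
  "levy_process M Y \<Longrightarrow> 0 \<le> t \<Longrightarrow> Y t \<in> borel_measurable M"
  by (simp add: levy_process_def)

lemma levy_process_0: "levy_process M Y \<Longrightarrow> AE \<omega> in M. Y 0 \<omega> = 0"
  by (simp add: levy_process_def)

lemma levy_increment_distr:
  assumes "levy_process M Y" "0 \<le> s" "0 \<le> h"
  shows "distr M borel (\<lambda>\<omega>. Y (s + h) \<omega> - Y s \<omega>) = distr M borel (Y h)"
  using assms by (simp add: levy_process_def)

lemma indep_sets_imp_indep_set:
  assumes F: "indep_sets F I" and ij: "i \<in> I" "j \<in> I" "i \<noteq> j"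
  shows "indep_set (F i) (F j)"
proof (rule indep_setI)
  show "F i \<subseteq> events" "F j \<subseteq> events" using F ij by (auto simp: indep_sets_def)
  fix a b assume ab: "a \<in> F i" "b \<in> F j"
  have "prob (\<Inter>k\<in>{i, j}. if k = i then a else b) = (\<Prod>k\<in>{i, j}. prob (if k = i then a else b))"
    by (rule indep_setsD[OF F]) (use ij ab in auto)
  then show "prob (a \<inter> b) = prob a * prob b" using ij(3) by (simp add: Int_commute)
qed

lemma indep_vars_imp_indep_var:
  assumes X: "indep_vars N X I" and ij: "i \<in> I" "j \<in> I" "i \<noteq> j"
  shows "indep_var (N i) (X i) (N j) (X j)"
  using X ij indep_sets_imp_indep_set[OF _ ij, of "\<lambda>i. sigma_sets (space M) {X i -` A \<inter> space M | A. A \<in> sets (N i)}"]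
  unfolding indep_vars_def indep_var_eq by blast

text \<open>
  The increment from 0 is used instead of \<open>Y s\<close> because \<open>Y 0\<close> vanishes only almost surely; both have the
  same law.
\<close>

lemma levy_increments_indep:
  assumes Y: "levy_process M Y" and s: "0 \<le> s" and h: "0 \<le> h"
  shows "indep_var borel (\<lambda>\<omega>. Y s \<omega> - Y 0 \<omega>) borel (\<lambda>\<omega>. Y (s + h) \<omega> - Y s \<omega>)"
proof -
  \<comment> \<open>the partition \<open>0 \<le> s \<le> s + h\<close>, continued constantly\<close>
  define t :: "nat \<Rightarrow> real" where "t n = (if n = 0 then 0 else if n = 1 then s else s + h)" for n
  have "0 \<le> t 0 \<and> (\<forall>i<2. t i \<le> t (Suc i))" using s h by (auto simp: t_def)
  then have "indep_vars (\<lambda>_. borel) (\<lambda>i \<omega>. Y (t (Suc i)) \<omega> - Y (t i) \<omega>) {..<2}"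
    using Y unfolding levy_process_def by blast
  from indep_vars_imp_indep_var[OF this, of 0 1] show ?thesis by (simp add: t_def)
qed

lemma levy_increment_square_integrable:
  assumes Y: "levy_process M Y" and s: "0 \<le> s" and h: "0 \<le> h"
  shows "square_integrable M (\<lambda>\<omega>. Y (s + h) \<omega> - Y s \<omega>) \<longleftrightarrow> square_integrable M (Y h)"
proof -
  have [measurable]: "Y s \<in> borel_measurable M" "Y (s + h) \<in> borel_measurable M"
    using Y s h by (auto intro: levy_process_measurable)
  have m: "(\<lambda>\<omega>. Y (s + h) \<omega> - Y s \<omega>) \<in> borel_measurable M" "Y h \<in> borel_measurable M"
    using Y h by (auto intro: levy_process_measurable)
  show ?thesis
    using square_integrable_cong_distr[OF levy_increment_distr[OF Y s h] m]
      square_integrable_cong_distr[OF levy_increment_distr[OF Y s h, symmetric] m(2,1)] by blast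
qed

lemma levy_increment_expectation:
  fixes f :: "'b :: {real_normed_vector, second_countable_topology} \<Rightarrow> 'e :: {banach, second_countable_topology}"
  assumes Y: "levy_process M Y" and s: "0 \<le> s" and h: "0 \<le> h" and f: "f \<in> borel_measurable borel"
  shows "(\<integral>\<omega>. f (Y (s + h) \<omega> - Y s \<omega>) \<partial>M) = (\<integral>\<omega>. f (Y h \<omega>) \<partial>M)"
proof -
  have [measurable]: "Y s \<in> borel_measurable M" "Y (s + h) \<in> borel_measurable M"
    using Y s h by (auto intro: levy_process_measurable)
  show ?thesis
    by (rule expectation_cong_distr[OF levy_increment_distr[OF Y s h] _ _ f])
      (use Y h in \<open>auto intro: levy_process_measurable\<close>)
qed

text \<open>
  Downwards, \<open>Y u\<close> is, up to \<open>Y 0\<close>, an independent summand of \<open>Y r\<close> for \<open>u \<le> r\<close>.  Upwards,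
  \<open>Y (2 r)\<close> is the sum of two increments with the law of \<open>Y r\<close>.
\<close>

lemma levy_square_integrable_all_times:
  fixes Y :: "real \<Rightarrow> 'a \<Rightarrow> 'b :: {banach, second_countable_topology}"
  assumes Y: "levy_process M Y" and s: "0 < s" "square_integrable M (Y s)" and t: "0 \<le> t"
  shows "square_integrable M (Y t)"
proof -
  define D where "D u = (\<lambda>\<omega>. Y u \<omega> - Y 0 \<omega>)" for u
  have D: "square_integrable M (D u) \<longleftrightarrow> square_integrable M (Y u)" if "0 \<le> u" for u
    using levy_increment_square_integrable[OF Y order_refl that] by (simp only: D_def add_0)
  have down: "square_integrable M (Y u)" if r: "square_integrable M (Y r)" and u: "0 \<le> u" "u \<le> r" for u r
  proof -
    have "D r = (\<lambda>\<omega>. D u \<omega> + (Y (u + (r - u)) \<omega> - Y u \<omega>))" by (simp add: D_def)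
    moreover have "square_integrable M (D r)" using D[of r] r u by linarith
    ultimately have "square_integrable M (D u)"
      using levy_increments_indep[OF Y u(1), of "r - u", folded D_def] u
      by (intro indep_var_square_integrable_summand[of "D u"]) auto
    then show ?thesis using D[OF u(1)] by blast
  qed
  have up: "square_integrable M (Y (2 * r))" if r: "0 \<le> r" "square_integrable M (Y r)" for r
  proof -
    have "square_integrable M (\<lambda>\<omega>. D r \<omega> + (Y (r + r) \<omega> - Y r \<omega>))"
      using r D[OF r(1)] levy_increment_square_integrable[OF Y r(1) r(1)]
      by (intro square_integrable_add) blast+
    moreover have "D (r + r) = (\<lambda>\<omega>. D r \<omega> + (Y (r + r) \<omega> - Y r \<omega>))" by (simp add: D_def)
    ultimately have "square_integrable M (D (r + r))" by (simp only:)
    then have "square_integrable M (Y (r + r))" using D[of "r + r"] r(1) by linarith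
    then show ?thesis by (simp only: mult_2)
  qed
  have "square_integrable M (Y (2 ^ n * s))" for n
  proof (induction n)
    case (Suc n)
    then show ?case using up[of "2 ^ n * s"] s(1) by (simp add: mult.assoc)
  qed (use s in simp)
  moreover obtain n :: nat where "t / s < 2 ^ n" using real_arch_pow[of 2 "t / s"] by auto
  moreover from this have "t \<le> 2 ^ n * s" using s(1) by (simp add: pos_divide_less_eq)
  ultimately show ?thesis using down t by blast
qed

lemma bilinear_covariance:
  fixes b :: "'b :: {banach, second_countable_topology} \<Rightarrow> 'b \<Rightarrow> real"
  assumes b: "bounded_bilinear b" and X: "square_integrable M X" and Y: "square_integrable M Y"
  shows "(\<integral>\<omega>. b (X \<omega> - integral\<^sup>L M X) (Y \<omega> - integral\<^sup>L M Y) \<partial>M) =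
    (\<integral>\<omega>. b (X \<omega>) (Y \<omega>) \<partial>M) - b (integral\<^sup>L M X) (integral\<^sup>L M Y)"
proof -
  note iX = square_integrable_integrable[OF X] and iY = square_integrable_integrable[OF Y]
  note bl = bounded_bilinear.bounded_linear_left[OF b] and br = bounded_bilinear.bounded_linear_right[OF b]
  have "b (X \<omega> - integral\<^sup>L M X) (Y \<omega> - integral\<^sup>L M Y) = b (X \<omega>) (Y \<omega>)
    - b (X \<omega>) (integral\<^sup>L M Y) - b (integral\<^sup>L M X) (Y \<omega>) + b (integral\<^sup>L M X) (integral\<^sup>L M Y)" for \<omega>
    by (simp add: bounded_bilinear.diff_left[OF b] bounded_bilinear.diff_right[OF b])
  then have "(\<integral>\<omega>. b (X \<omega> - integral\<^sup>L M X) (Y \<omega> - integral\<^sup>L M Y) \<partial>M) =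
      (\<integral>\<omega>. b (X \<omega>) (Y \<omega>) - b (X \<omega>) (integral\<^sup>L M Y) - b (integral\<^sup>L M X) (Y \<omega>)
        + b (integral\<^sup>L M X) (integral\<^sup>L M Y) \<partial>M)"
    by (rule Bochner_Integration.integral_cong[OF refl])
  also have "\<dots> = (\<integral>\<omega>. b (X \<omega>) (Y \<omega>) \<partial>M) - (\<integral>\<omega>. b (X \<omega>) (integral\<^sup>L M Y) \<partial>M)
      - (\<integral>\<omega>. b (integral\<^sup>L M X) (Y \<omega>) \<partial>M) + b (integral\<^sup>L M X) (integral\<^sup>L M Y)"
    using square_integrable_bilinear[OF b X Y] integrable_bounded_linear[OF bl iX]
      integrable_bounded_linear[OF br iY] by (simp add: prob_space)
  finally show ?thesis
    by (simp add: integral_bounded_linear[OF bl iX] integral_bounded_linear[OF br iY])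
qed

lemma bounded_bilinear_diagonal_measurable:
  fixes b :: "'b :: {banach, second_countable_topology} \<Rightarrow> 'b \<Rightarrow> real"
  assumes b: "bounded_bilinear b"
  shows "(\<lambda>x. b x x) \<in> borel_measurable borel"
  by (intro borel_measurable_continuous_onI bounded_bilinear.continuous_on[OF b] continuous_on_id)

text \<open>
  Write \<open>Y (s + h)\<close>, up to \<open>Y 0\<close>, as \<open>D s + E\<close> with independent increments \<open>D s\<close> and \<open>E\<close> that have the
  laws of \<open>Y s\<close> and \<open>Y h\<close>.  By independence the mixed terms of \<open>b (D s + E) (D s + E)\<close> have the
  expectations \<open>b m\<^sub>s m\<^sub>h\<close> and \<open>b m\<^sub>h m\<^sub>s\<close>, where \<open>m\<^sub>u\<close> is the mean of \<open>Y u\<close>; these cancel against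
  the mixed terms of \<open>b (m\<^sub>s + m\<^sub>h) (m\<^sub>s + m\<^sub>h)\<close>.
\<close>

lemma
  fixes Y :: "real \<Rightarrow> 'a \<Rightarrow> 'b :: {banach, second_countable_topology}" and b :: "'b \<Rightarrow> 'b \<Rightarrow> real"
  assumes Y: "levy_process M Y" and sq: "\<And>t. 0 \<le> t \<Longrightarrow> square_integrable M (Y t)"
    and s: "0 \<le> s" and h: "0 \<le> h"
  shows levy_mean_add: "integral\<^sup>L M (Y (s + h)) = integral\<^sup>L M (Y s) + integral\<^sup>L M (Y h)"
    and levy_covariance_add: "bounded_bilinear b \<Longrightarrow>
      (\<integral>\<omega>. b (Y (s + h) \<omega>) (Y (s + h) \<omega>) \<partial>M) - b (integral\<^sup>L M (Y (s + h))) (integral\<^sup>L M (Y (s + h)))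
      = ((\<integral>\<omega>. b (Y s \<omega>) (Y s \<omega>) \<partial>M) - b (integral\<^sup>L M (Y s)) (integral\<^sup>L M (Y s)))
      + ((\<integral>\<omega>. b (Y h \<omega>) (Y h \<omega>) \<partial>M) - b (integral\<^sup>L M (Y h)) (integral\<^sup>L M (Y h)))"
proof -
  define D where "D u \<omega> = Y u \<omega> - Y 0 \<omega>" for u \<omega>
  define E where "E \<omega> = Y (s + h) \<omega> - Y s \<omega>" for \<omega>
  have sh: "0 \<le> s + h" using s h by simp
  have D: "square_integrable M (D u)" "(\<integral>\<omega>. f (D u \<omega>) \<partial>M) = (\<integral>\<omega>. f (Y u \<omega>) \<partial>M)"
    if "0 \<le> u" "f \<in> borel_measurable borel" for u and f :: "'b \<Rightarrow> real"
    using levy_increment_square_integrable[OF Y order_refl that(1)] sq[OF that(1)]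
      levy_increment_expectation[OF Y order_refl that] by (auto simp: D_def[abs_def])
  have mD: "integral\<^sup>L M (D u) = integral\<^sup>L M (Y u)" if "0 \<le> u" for u
    using levy_increment_expectation[OF Y order_refl that, of "\<lambda>x. x"] by (simp add: D_def[abs_def])
  have E: "square_integrable M E"
    using levy_increment_square_integrable[OF Y s h] sq[OF h] by (simp add: E_def[abs_def])
  have E': "(\<integral>\<omega>. f (E \<omega>) \<partial>M) = (\<integral>\<omega>. f (Y h \<omega>) \<partial>M)"
    if "f \<in> borel_measurable borel" for f :: "'b \<Rightarrow> real"
    using levy_increment_expectation[OF Y s h that] by (simp add: E_def[abs_def])
  have mE: "integral\<^sup>L M E = integral\<^sup>L M (Y h)"
    using levy_increment_expectation[OF Y s h, of "\<lambda>x. x"] by (simp add: E_def[abs_def])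
  have DE: "D (s + h) = (\<lambda>\<omega>. D s \<omega> + E \<omega>)" by (auto simp: D_def E_def)
  have ind: "indep_var borel (D s) borel E"
    using levy_increments_indep[OF Y s h] by (simp add: D_def[abs_def] E_def[abs_def])
  have Ds: "square_integrable M (D s)" using D(1)[OF s borel_measurable_const] .
  show mean: "integral\<^sup>L M (Y (s + h)) = integral\<^sup>L M (Y s) + integral\<^sup>L M (Y h)"
    using Bochner_Integration.integral_add[OF square_integrable_integrable[OF Ds] square_integrable_integrable[OF E]]
    by (simp only: DE[symmetric] mD[OF sh] mD[OF s] mE)
  assume b: "bounded_bilinear b"
  note bm = bounded_bilinear_diagonal_measurable[OF b]
  have "(\<integral>\<omega>. b (Y (s + h) \<omega>) (Y (s + h) \<omega>) \<partial>M) = (\<integral>\<omega>. b (D s \<omega> + E \<omega>) (D s \<omega> + E \<omega>) \<partial>M)"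
    using D(2)[OF sh bm] by (simp only: DE)
  also have "\<dots> = (\<integral>\<omega>. (b (D s \<omega>) (D s \<omega>) + b (D s \<omega>) (E \<omega>)) + (b (E \<omega>) (D s \<omega>) + b (E \<omega>) (E \<omega>)) \<partial>M)"
    by (simp add: bounded_bilinear.add_left[OF b] bounded_bilinear.add_right[OF b] algebra_simps)
  also have "\<dots> = ((\<integral>\<omega>. b (D s \<omega>) (D s \<omega>) \<partial>M) + (\<integral>\<omega>. b (D s \<omega>) (E \<omega>) \<partial>M))
      + ((\<integral>\<omega>. b (E \<omega>) (D s \<omega>) \<partial>M) + (\<integral>\<omega>. b (E \<omega>) (E \<omega>) \<partial>M))"
    by (simp add: square_integrable_bilinear[OF b] Ds E)
  also have "\<dots> = ((\<integral>\<omega>. b (Y s \<omega>) (Y s \<omega>) \<partial>M) + b (integral\<^sup>L M (Y s)) (integral\<^sup>L M (Y h)))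
      + (b (integral\<^sup>L M (Y h)) (integral\<^sup>L M (Y s)) + (\<integral>\<omega>. b (Y h \<omega>) (Y h \<omega>) \<partial>M))"
    by (simp only: D(2)[OF s bm] E'[OF bm] indep_var_bilinear_expectation[OF b Ds E ind]
        indep_var_bilinear_expectation[OF b E Ds indep_var_commute[OF ind]] mD[OF s] mE)
  finally show "(\<integral>\<omega>. b (Y (s + h) \<omega>) (Y (s + h) \<omega>) \<partial>M) - b (integral\<^sup>L M (Y (s + h))) (integral\<^sup>L M (Y (s + h)))
      = ((\<integral>\<omega>. b (Y s \<omega>) (Y s \<omega>) \<partial>M) - b (integral\<^sup>L M (Y s)) (integral\<^sup>L M (Y s)))
      + ((\<integral>\<omega>. b (Y h \<omega>) (Y h \<omega>) \<partial>M) - b (integral\<^sup>L M (Y h)) (integral\<^sup>L M (Y h)))"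
    by (simp add: mean bounded_bilinear.add_left[OF b] bounded_bilinear.add_right[OF b])
qed

text \<open>
  The variance is the covariance form of the inner product, so it is additive in time; it is also
  nonnegative.
\<close>

lemma levy_variance_tendsto_0:
  fixes Y :: "real \<Rightarrow> 'a \<Rightarrow> 'b :: {real_inner, banach, second_countable_topology}"
  assumes Y: "levy_process M Y" and sq: "\<And>t. 0 \<le> t \<Longrightarrow> square_integrable M (Y t)"
  shows "((\<lambda>s. \<integral>\<omega>. (norm (Y s \<omega> - integral\<^sup>L M (Y s)))\<^sup>2 \<partial>M) \<longlongrightarrow> 0) (at_right 0)"
proof (rule additive_nonneg_tendsto_0)
  fix s t :: real assume st: "0 \<le> s" "0 \<le> t"
  have v: "(\<integral>\<omega>. (norm (Y u \<omega> - integral\<^sup>L M (Y u)))\<^sup>2 \<partial>M)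
      = (\<integral>\<omega>. Y u \<omega> \<bullet> Y u \<omega> \<partial>M) - integral\<^sup>L M (Y u) \<bullet> integral\<^sup>L M (Y u)" if "0 \<le> u" for u
    using bilinear_covariance[OF bounded_bilinear_inner sq[OF that] sq[OF that]]
    by (simp only: power2_norm_eq_inner)
  show "(\<integral>\<omega>. (norm (Y (s + t) \<omega> - integral\<^sup>L M (Y (s + t))))\<^sup>2 \<partial>M) =
      (\<integral>\<omega>. (norm (Y s \<omega> - integral\<^sup>L M (Y s)))\<^sup>2 \<partial>M) + (\<integral>\<omega>. (norm (Y t \<omega> - integral\<^sup>L M (Y t)))\<^sup>2 \<partial>M)"
    using levy_covariance_add[OF Y sq st bounded_bilinear_inner] st by (simp only: v add_nonneg_nonneg)
qed simp

text \<open>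
  For small \<open>s\<close>, \<open>Y s\<close> is close to 0 in probability by stochastic continuity and close to its mean in
  probability by Chebyshev's inequality.  A mean of norm at least \<open>2 r\<close> would force one of the two
  distances to be at least \<open>r\<close> at almost every sample point, although both events have small probability.
\<close>

lemma levy_mean_tendsto_0:
  fixes Y :: "real \<Rightarrow> 'a \<Rightarrow> 'b :: {real_inner, banach, second_countable_topology}"
  assumes Y: "levy_process M Y" and sq: "\<And>t. 0 \<le> t \<Longrightarrow> square_integrable M (Y t)"
  shows "((\<lambda>s. integral\<^sup>L M (Y s)) \<longlongrightarrow> 0) (at_right 0)"
proof (rule tendstoI)
  fix e :: real assume "e > 0"
  define r where "r = e / 2"
  have r: "r > 0" using \<open>e > 0\<close> by (simp add: r_def)
  define v where "v s = (\<integral>\<omega>. (norm (Y s \<omega> - integral\<^sup>L M (Y s)))\<^sup>2 \<partial>M)" for s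
  define p where "p s = prob {\<omega> \<in> space M. r \<le> norm (Y s \<omega> - Y 0 \<omega>)}" for s
  have "(v \<longlongrightarrow> 0) (at_right 0)" using levy_variance_tendsto_0[OF Y sq] by (simp only: v_def[abs_def])
  moreover have "(p \<longlongrightarrow> 0) (at 0 within {0..})"
  proof -
    have "\<forall>t\<ge>0. \<forall>\<epsilon>>0. ((\<lambda>s. prob {\<omega> \<in> space M. \<epsilon> \<le> norm (Y s \<omega> - Y t \<omega>)}) \<longlongrightarrow> 0) (at t within {0..})"
      using Y unfolding levy_process_def by blast
    then show ?thesis using r unfolding p_def[abs_def] by blast
  qed
  then have "(p \<longlongrightarrow> 0) (at_right 0)" by (rule tendsto_within_subset) auto
  ultimately have "((\<lambda>s. v s / r\<^sup>2 + p s) \<longlongrightarrow> 0 / r\<^sup>2 + 0) (at_right 0)"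
    by (intro tendsto_intros) (use r in auto)
  then have "((\<lambda>s. v s / r\<^sup>2 + p s) \<longlongrightarrow> 0) (at_right 0)" by simp
  then have ev: "\<forall>\<^sub>F s in at_right 0. v s / r\<^sup>2 + p s < 1"
    by (rule order_tendstoD(2)) simp
  have pos: "\<forall>\<^sub>F s in at_right 0. 0 < (s :: real)" by (rule eventually_at_right_less)
  show "\<forall>\<^sub>F s in at_right 0. dist (integral\<^sup>L M (Y s)) 0 < e"
    using ev pos
  proof eventually_elim
    case (elim s)
    have [measurable]: "Y s \<in> borel_measurable M" "Y 0 \<in> borel_measurable M"
      using elim levy_process_measurable[OF Y] by auto
    define f where "f = integral\<^sup>L M (Y s)"
    show ?case
    proof (rule ccontr)
      assume "\<not> ?case"
      then have f: "2 * r \<le> norm f" by (simp add: r_def f_def)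
      let ?A = "{\<omega> \<in> space M. r\<^sup>2 \<le> (norm (Y s \<omega> - f))\<^sup>2}"
      let ?B = "{\<omega> \<in> space M. r \<le> norm (Y s \<omega> - Y 0 \<omega>)}"
      have m: "?A \<in> events" "?B \<in> events" by measurable
      have "AE \<omega> in M. \<omega> \<in> ?A \<union> ?B"
        using levy_process_0[OF Y]
      proof (rule AE_mp, intro AE_I2 impI)
        fix \<omega> assume w: "\<omega> \<in> space M" "Y 0 \<omega> = 0"
        have "norm f \<le> norm (Y s \<omega>) + norm (Y s \<omega> - f)"
          using norm_triangle_ineq4[of "Y s \<omega>" "Y s \<omega> - f"] by simp
        then have "r \<le> norm (Y s \<omega>) \<or> r \<le> norm (Y s \<omega> - f)" using f by linarith
        then have "r \<le> norm (Y s \<omega> - Y 0 \<omega>) \<or> r\<^sup>2 \<le> (norm (Y s \<omega> - f))\<^sup>2"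
          using r power_mono[of r "norm (Y s \<omega> - f)" 2] by (simp only: w diff_zero) linarith
        then show "\<omega> \<in> ?A \<union> ?B" using w(1) by blast
      qed
      then have "prob (?A \<union> ?B) = 1" using m prob_eq_1[of "?A \<union> ?B"] by blast
      moreover have "prob (?A \<union> ?B) \<le> prob ?A + prob ?B" by (rule measure_Un_le) (use m in auto)
      moreover have "prob ?A \<le> v s / r\<^sup>2"
        unfolding v_def f_def[symmetric]
      proof (rule integral_Markov_inequality_measure[OF _ sets.top])
        show "integrable M (\<lambda>\<omega>. (norm (Y s \<omega> - f))\<^sup>2)"
          using square_integrable_diff_const[OF sq[of s], of f] elim by (simp add: square_integrable_def)
      qed (use r in auto)
      moreover have "prob ?B = p s" by (simp only: p_def)
      ultimately show False using elim by linarith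
    qed
  qed
qed

lemma levy_mean_linear:
  fixes Y :: "real \<Rightarrow> 'a \<Rightarrow> 'b :: {real_inner, banach, second_countable_topology}"
  assumes Y: "levy_process M Y" and sq: "\<And>t. 0 \<le> t \<Longrightarrow> square_integrable M (Y t)" and s: "0 \<le> s"
  shows "integral\<^sup>L M (Y s) = s *\<^sub>R integral\<^sup>L M (Y 1)"
  using levy_mean_add[OF Y sq] levy_mean_tendsto_0[OF Y sq] s
  by (rule additive_tendsto_0_imp_linear[where g = "\<lambda>s. integral\<^sup>L M (Y s)"])

text \<open>
  The covariance form \<open>g\<close> is additive in time and dominated by the variance, which tends to 0 at time 0;
  hence it is linear.
\<close>

lemma levy_second_moment:
  fixes Y :: "real \<Rightarrow> 'a \<Rightarrow> 'b :: {real_inner, banach, second_countable_topology}"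
    and b :: "'b \<Rightarrow> 'b \<Rightarrow> real"
  assumes Y: "levy_process M Y" and sq: "\<And>t. 0 \<le> t \<Longrightarrow> square_integrable M (Y t)" and s: "0 \<le> s"
    and b: "bounded_bilinear b"
  defines "m \<equiv> integral\<^sup>L M (Y 1)"
  shows "(\<integral>\<omega>. b (Y s \<omega>) (Y s \<omega>) \<partial>M) = s\<^sup>2 * b m m + s * ((\<integral>\<omega>. b (Y 1 \<omega>) (Y 1 \<omega>) \<partial>M) - b m m)"
proof -
  define g where "g u = (\<integral>\<omega>. b (Y u \<omega>) (Y u \<omega>) \<partial>M) - b (integral\<^sup>L M (Y u)) (integral\<^sup>L M (Y u))" for u
  define v where "v s = (\<integral>\<omega>. (norm (Y s \<omega> - integral\<^sup>L M (Y s)))\<^sup>2 \<partial>M)" for s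
  obtain K where K: "\<And>x y. norm (b x y) \<le> norm x * norm y * K"
    using bounded_bilinear.nonneg_bounded[OF b] by blast
  have "norm (g u) \<le> v u * K" if u: "0 \<le> u" for u
  proof -
    let ?Z = "\<lambda>\<omega>. Y u \<omega> - integral\<^sup>L M (Y u)"
    have Z: "square_integrable M ?Z" using sq[OF u] by (rule square_integrable_diff_const)
    have "norm (g u) = norm (\<integral>\<omega>. b (?Z \<omega>) (?Z \<omega>) \<partial>M)"
      using bilinear_covariance[OF b sq[OF u] sq[OF u]] by (simp only: g_def)
    also have "\<dots> \<le> (\<integral>\<omega>. norm (b (?Z \<omega>) (?Z \<omega>)) \<partial>M)" by (rule integral_norm_bound)
    also have "\<dots> \<le> (\<integral>\<omega>. (norm (?Z \<omega>))\<^sup>2 * K \<partial>M)"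
    proof (rule integral_mono)
      show "integrable M (\<lambda>\<omega>. norm (b (?Z \<omega>) (?Z \<omega>)))"
        using square_integrable_bilinear[OF b Z Z] by (rule integrable_norm)
      show "integrable M (\<lambda>\<omega>. (norm (?Z \<omega>))\<^sup>2 * K)" using Z by (simp add: square_integrable_def)
    qed (use K in \<open>simp add: power2_eq_square\<close>)
    also have "\<dots> = v u * K" by (simp add: v_def)
    finally show ?thesis .
  qed
  then have le: "\<forall>\<^sub>F u in at_right 0. norm (g u) \<le> v u * K"
    using eventually_at_right_less[of "0 :: real"] by (auto elim: eventually_mono)
  have "(v \<longlongrightarrow> 0) (at_right 0)" using levy_variance_tendsto_0[OF Y sq] by (simp only: v_def[abs_def])
  then have "((\<lambda>u. v u * K) \<longlongrightarrow> 0 * K) (at_right 0)" by (intro tendsto_intros)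
  then have "((\<lambda>u. v u * K) \<longlongrightarrow> 0) (at_right 0)" by simp
  from Lim_null_comparison[OF le this] have lim: "(g \<longlongrightarrow> 0) (at_right 0)" .
  have "g s = s *\<^sub>R g 1"
    using levy_covariance_add[OF Y sq _ _ b] lim s
    by (intro additive_tendsto_0_imp_linear[where g = g]) (simp_all only: g_def[symmetric])
  moreover have "integral\<^sup>L M (Y s) = s *\<^sub>R m"
    unfolding m_def by (rule levy_mean_linear[OF Y _ s]) (rule sq)
  then have "b (integral\<^sup>L M (Y s)) (integral\<^sup>L M (Y s)) = s\<^sup>2 * b m m"
    by (simp add: bounded_bilinear.scaleR_left[OF b] bounded_bilinear.scaleR_right[OF b] power2_eq_square)
  ultimately show ?thesis by (simp add: g_def m_def)
qed

end

section \<open>Right-continuous processes and random times\<close>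

text \<open>
  Round the random time up to the grid of mesh \<open>1 / (n + 1)\<close>.  Then only countably many times occur, and
  the resulting map is measurable.  Rounding strictly upwards makes the rounded times approach the random
  time from the right, so that right-continuity gives pointwise convergence.
\<close>

lemma right_continuous_random_time_measurable:
  fixes Y :: "real \<Rightarrow> 'w \<Rightarrow> 'b :: metric_space"
  assumes Y: "\<And>t. 0 \<le> t \<Longrightarrow> Y t \<in> borel_measurable T"
    and rc: "\<And>\<omega> t. \<omega> \<in> space T \<Longrightarrow> 0 \<le> t \<Longrightarrow> ((\<lambda>s. Y s \<omega>) \<longlongrightarrow> Y t \<omega>) (at_right t)"
    and \<tau>: "\<tau> \<in> borel_measurable S" "\<And>\<omega>. \<omega> \<in> space S \<Longrightarrow> 0 \<le> \<tau> \<omega>"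
  shows "(\<lambda>z. Y (\<tau> (fst z)) (snd z)) \<in> borel_measurable (S \<Otimes>\<^sub>M T)"
proof -
  define k where "k n z = nat \<lfloor>real (Suc n) * \<tau> (fst z)\<rfloor>" for n :: nat and z :: "_ \<times> 'w"
  define a where "a n i = (real i + 1) / real (Suc n)" for n i :: nat
  show ?thesis
  proof (rule borel_measurable_LIMSEQ_metric)
    have k: "k n \<in> measurable (S \<Otimes>\<^sub>M T) (count_space UNIV)" for n
    proof -
      have "(\<lambda>z. \<tau> (fst z)) \<in> borel_measurable (S \<Otimes>\<^sub>M T)"
        by (rule measurable_compose[OF measurable_fst \<tau>(1)])
      then show ?thesis unfolding k_def[abs_def] by measurable
    qed
    fix n
    have "(\<lambda>z. Y (a n i) (snd z)) \<in> borel_measurable (S \<Otimes>\<^sub>M T)" for i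
      by (rule measurable_compose[OF measurable_snd Y]) (simp add: a_def)
    then show "(\<lambda>z. Y (a n (k n z)) (snd z)) \<in> borel_measurable (S \<Otimes>\<^sub>M T)"
      using k[of n] by (rule measurable_compose_countable)
  next
    fix z assume "z \<in> space (S \<Otimes>\<^sub>M T)"
    then have z: "fst z \<in> space S" "snd z \<in> space T" by (auto simp: space_pair_measure)
    define x where "x = \<tau> (fst z)"
    have x: "0 \<le> x" using \<tau>(2) z by (simp add: x_def)
    have a: "x < a n (k n z)" "a n (k n z) \<le> x + inverse (real (Suc n))" for n
    proof -
      have k': "real (k n z) \<le> real (Suc n) * x" "real (Suc n) * x < real (k n z) + 1"
        using x of_nat_floor[of "real (Suc n) * x"] floor_correct[of "real (Suc n) * x"]
        by (simp_all add: k_def x_def[symmetric] del: of_nat_Suc)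
      then show "x < a n (k n z)" unfolding a_def by (subst pos_less_divide_eq) (auto simp: mult.commute)
      show "a n (k n z) \<le> x + inverse (real (Suc n))"
      proof -
        have "(x + inverse (real (Suc n))) * real (Suc n) = real (Suc n) * x + 1" 
          by (simp add: distrib_left distrib_right mult.commute del: of_nat_Suc)
        then show ?thesis using k'(1) unfolding a_def by (subst pos_divide_le_eq) auto
      qed
    qed
    have "(\<lambda>n. x + inverse (real (Suc n))) \<longlonglongrightarrow> x + 0"
      by (intro tendsto_intros LIMSEQ_inverse_real_of_nat)
    then have "(\<lambda>n. a n (k n z)) \<longlonglongrightarrow> x"
      unfolding add_0_right
      by (rule tendsto_sandwich[rotated 3, where h = "\<lambda>n. x + inverse (real (Suc n))" and f = "\<lambda>_. x"])
        (intro tendsto_const always_eventually allI less_imp_le[OF a(1)] a(2))+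
    then have "filterlim (\<lambda>n. a n (k n z)) (at_right x) sequentially"
      by (rule tendsto_imp_filterlim_at_right) (intro always_eventually allI a(1))
    then show "(\<lambda>n. Y (a n (k n z)) (snd z)) \<longlonglongrightarrow> Y (\<tau> (fst z)) (snd z)"
      using filterlim_compose[OF rc[OF z(2) x]] by (simp only: x_def)
  qed
qed

text \<open>
  One null set serves all rational times, and right-continuity extends the conclusion to all times.
\<close>

lemma right_continuous_zero_process:
  fixes Y :: "real \<Rightarrow> 'w \<Rightarrow> 'b :: {t1_space, zero}"
  assumes rc: "\<And>\<omega> t. \<omega> \<in> space M \<Longrightarrow> 0 \<le> t \<Longrightarrow> ((\<lambda>s. Y s \<omega>) \<longlongrightarrow> Y t \<omega>) (at_right t)"
    and z: "\<And>t. 0 \<le> t \<Longrightarrow> AE \<omega> in M. Y t \<omega> = 0"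
  shows "zero_process M Y"
proof -
  have "AE \<omega> in M. \<forall>q::rat. 0 \<le> q \<longrightarrow> Y (of_rat q) \<omega> = 0"
    unfolding AE_all_countable
  proof
    fix q :: rat
    show "AE \<omega> in M. 0 \<le> q \<longrightarrow> Y (of_rat q) \<omega> = 0"
    proof (cases "0 \<le> q")
      case True
      then have "AE \<omega> in M. Y (of_rat q) \<omega> = 0" by (intro z) simp
      then show ?thesis by (rule AE_mp) simp
    qed simp
  qed
  then show ?thesis
    unfolding zero_process_def
  proof (rule AE_mp, intro AE_I2 impI allI)
    fix \<omega> t assume w: "\<omega> \<in> space M" and q: "\<forall>q::rat. 0 \<le> q \<longrightarrow> Y (of_rat q) \<omega> = 0" and t: "0 \<le> (t::real)"
    show "Y t \<omega> = 0"
    proof (rule ccontr)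
      assume "Y t \<omega> \<noteq> 0"
      from tendsto_imp_eventually_ne[OF rc[OF w t] this]
      obtain u where u: "u > t" "\<And>s. t < s \<Longrightarrow> s < u \<Longrightarrow> Y s \<omega> \<noteq> 0"
        unfolding eventually_at_right_field by blast
      obtain r :: rat where r: "t < of_rat r" "of_rat r < u" using of_rat_dense[OF u(1)] by blast
      then have "(0::real) \<le> of_rat r" using t by linarith
      then have "0 \<le> r" by simp
      then show False using q u(2)[OF r] by blast
    qed
  qed
qed

lemma square_integrable_process_iff:
  "square_integrable_process M Y \<longleftrightarrow> (\<forall>t\<ge>0. square_integrable M (Y t))"
  by (simp add: square_integrable_process_def square_integrable_def)

definition process_algebra ::
    "'w measure \<Rightarrow> (real \<Rightarrow> 'w \<Rightarrow> 'b :: topological_space) \<Rightarrow> 'w measure"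
where
  "process_algebra M Y = sigma (space M) (process_events M Y)"

lemma process_events_subset: "process_events M Y \<subseteq> Pow (space M)"
proof
  fix A assume "A \<in> process_events M Y"
  then have "A \<subseteq> space M" unfolding process_events_def by (rule sigma_sets_into_sp[rotated]) auto
  then show "A \<in> Pow (space M)" by simp
qed

lemma space_process_algebra [simp]: "space (process_algebra M Y) = space M"
  by (simp add: process_algebra_def process_events_subset)

lemma sets_process_algebra: "sets (process_algebra M Y) = process_events M Y"
proof -
  have "sigma_sets (space M) (process_events M Y) = process_events M Y"
    unfolding process_events_def by (rule sigma_sets_sigma_sets_eq) auto
  then show ?thesis by (simp add: process_algebra_def process_events_subset)
qed

lemma measurable_process_algebra:
  assumes "0 \<le> t" shows "Y t \<in> measurable (process_algebra M Y) borel"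
proof (rule measurableI)
  fix A :: "'b set" assume "A \<in> sets borel"
  then show "Y t -` A \<inter> space (process_algebra M Y) \<in> sets (process_algebra M Y)"
    unfolding sets_process_algebra space_process_algebra process_events_def
    using assms by (intro sigma_sets.Basic) blast
qed simp

context prob_space
begin

text \<open>
  Taking the identity on the sample space as both random variables, with two different \<open>\<sigma>\<close>-algebras on
  the target, makes Fubini's theorem applicable to entire processes.
\<close>

lemma indep_process_events_imp_indep_var:
  assumes "indep_set (process_events M Y) (process_events M Z)"
  shows "indep_var (process_algebra M Y) (\<lambda>\<omega>. \<omega>) (process_algebra M Z) (\<lambda>\<omega>. \<omega>)"
proof -
  have eq: "sigma_sets (space M) {(\<lambda>\<omega>. \<omega>) -` A \<inter> space M |A. A \<in> sets N} = sets N"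
    if "space N = space M" for N :: "'a measure"
  proof -
    have "(\<lambda>\<omega>. \<omega>) -` A \<inter> space M = A" if "A \<in> sets N" for A
      using sets.sets_into_space[OF that] \<open>space N = space M\<close> by blast
    then have "{(\<lambda>\<omega>. \<omega>) -` A \<inter> space M |A. A \<in> sets N} = (\<lambda>A. A) ` sets N"
      unfolding Setcompr_eq_image by (intro image_cong refl)
    then show ?thesis using sets.sigma_sets_eq[of N] that by simp
  qed
  have m: "(\<lambda>\<omega>. \<omega>) \<in> measurable M N" if "space N = space M" "sets N \<subseteq> events" for N :: "'a measure"
  proof (rule measurableI)
    fix A assume A: "A \<in> sets N"
    then have "(\<lambda>\<omega>. \<omega>) -` A \<inter> space M = A" using sets.sets_into_space[OF A] that(1) by blast
    then show "(\<lambda>\<omega>. \<omega>) -` A \<inter> space M \<in> events" using A that(2) by (simp only: subset_iff)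
  qed (simp add: that)
  show ?thesis
    unfolding indep_var_eq
    unfolding eq[OF space_process_algebra[of M Y]] eq[OF space_process_algebra[of M Z]]
    unfolding sets_process_algebra
    by (intro conjI m space_process_algebra assms;
        simp only: sets_process_algebra indep_setD_ev1[OF assms] indep_setD_ev2[OF assms])
qed

end

section \<open>Random vectors with Hilbert space components\<close>

lemma vec_nth_measurable: "(\<lambda>v :: 'b :: real_normed_vector ^ 'd. v $ i) \<in> borel_measurable borel"
  by (intro borel_measurable_continuous_onI linear_continuous_on bounded_linear_vec_nth)

lemma norm_vec_square: "(norm (v :: 'b :: real_normed_vector ^ 'd))\<^sup>2 = (\<Sum>i\<in>UNIV. (norm (v $ i))\<^sup>2)"
  by (simp add: norm_vec_def L2_set_def sum_nonneg)

lemma bounded_linear_axis: "bounded_linear (axis i :: 'b :: real_normed_vector \<Rightarrow> 'b ^ 'd)"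
proof (rule bounded_linear_intro[where K = 1])
  fix x :: 'b
  have "(norm (axis i x :: 'b ^ 'd))\<^sup>2 = (\<Sum>j\<in>UNIV. if i = j then (norm x)\<^sup>2 else 0)"
    unfolding norm_vec_square by (intro sum.cong) (auto simp: axis_def)
  then have "(norm (axis i x :: 'b ^ 'd))\<^sup>2 = (norm x)\<^sup>2" by simp
  then show "norm (axis i x :: 'b ^ 'd) \<le> norm x * 1"
    by (simp add: power2_eq_iff_nonneg)
qed (auto simp: vec_eq_iff axis_def)

lemma vec_eq_sum_axis: "(v :: 'b :: real_vector ^ 'd) = (\<Sum>i\<in>UNIV. axis i (v $ i))"
  by (simp add: vec_eq_iff axis_def)

lemma vec_measurable:
  fixes Z :: "'w \<Rightarrow> 'b :: {real_normed_vector, second_countable_topology} ^ 'd"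
  assumes "\<And>i. (\<lambda>\<omega>. Z \<omega> $ i) \<in> borel_measurable M"
  shows "Z \<in> borel_measurable M"
proof -
  have "(\<lambda>\<omega>. \<Sum>i\<in>UNIV. axis i (Z \<omega> $ i) :: 'b ^ 'd) \<in> borel_measurable M"
    by (intro borel_measurable_sum measurable_compose[OF assms]
        borel_measurable_continuous_onI linear_continuous_on bounded_linear_axis)
  then show ?thesis by (simp only: vec_eq_sum_axis[symmetric])
qed

lemma square_integrable_vec:
  fixes Z :: "'w \<Rightarrow> 'b :: {banach, second_countable_topology} ^ 'd"
  shows "square_integrable M Z \<longleftrightarrow> (\<forall>i. square_integrable M (\<lambda>\<omega>. Z \<omega> $ i))"
proof safe
  fix i assume Z: "square_integrable M Z"
  then have m: "(\<lambda>\<omega>. Z \<omega> $ i) \<in> borel_measurable M"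
    using measurable_compose[OF _ vec_nth_measurable] by (auto simp: square_integrable_def)
  moreover have "integrable M (\<lambda>\<omega>. (norm (Z \<omega> $ i))\<^sup>2)"
  proof (rule Bochner_Integration.integrable_bound)
    show "integrable M (\<lambda>\<omega>. (norm (Z \<omega>))\<^sup>2)" using Z by (simp add: square_integrable_def)
    show "(\<lambda>\<omega>. (norm (Z \<omega> $ i))\<^sup>2) \<in> borel_measurable M" using m by measurable
    show "AE \<omega> in M. norm ((norm (Z \<omega> $ i))\<^sup>2) \<le> norm ((norm (Z \<omega>))\<^sup>2)"
      by (intro AE_I2) (simp add: power_mono Finite_Cartesian_Product.norm_nth_le)
  qed
  ultimately show "square_integrable M (\<lambda>\<omega>. Z \<omega> $ i)" by (simp add: square_integrable_def)
next
  assume "\<forall>i. square_integrable M (\<lambda>\<omega>. Z \<omega> $ i)"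
  then show "square_integrable M Z"
    by (auto simp: square_integrable_def norm_vec_square intro!: vec_measurable)
qed

lemma integral_vec_nth:
  fixes Z :: "'w \<Rightarrow> 'b :: {banach, second_countable_topology} ^ 'd"
  assumes "integrable M Z"
  shows "integral\<^sup>L M Z $ i = (\<integral>\<omega>. Z \<omega> $ i \<partial>M)"
  using integral_bounded_linear[OF bounded_linear_vec_nth assms] by (rule sym)

lemma bounded_bilinear_inner_mult:
  fixes x y :: "'b :: real_inner"
  shows "bounded_bilinear (\<lambda>u v. (u \<bullet> x) * (v \<bullet> y))"
  by (rule bounded_bilinear.comp[OF bounded_bilinear_mult bounded_linear_inner_left bounded_linear_inner_left])

lemma (in prob_space) covariance_components:
  fixes Z :: "'a \<Rightarrow> 'b :: {real_inner, banach, second_countable_topology} ^ 'd"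
  assumes Z: "square_integrable M Z"
  shows "(\<integral>\<omega>. ((Z \<omega> - integral\<^sup>L M Z) \<bullet> x) * ((Z \<omega> - integral\<^sup>L M Z) \<bullet> y) \<partial>M) =
    (\<Sum>i\<in>UNIV. \<Sum>j\<in>UNIV. (\<integral>\<omega>. (Z \<omega> $ i \<bullet> x $ i) * (Z \<omega> $ j \<bullet> y $ j) \<partial>M)
      - ((\<integral>\<omega>. Z \<omega> $ i \<partial>M) \<bullet> x $ i) * ((\<integral>\<omega>. Z \<omega> $ j \<partial>M) \<bullet> y $ j))"
proof -
  let ?m = "integral\<^sup>L M Z"
  have Zi: "square_integrable M (\<lambda>\<omega>. Z \<omega> $ i)" for i using Z square_integrable_vec[of M Z] by blast
  have int: "integrable M (\<lambda>\<omega>. (Z \<omega> $ i \<bullet> x $ i) * (Z \<omega> $ j \<bullet> y $ j))" for i j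
  proof -
    have "bounded_bilinear (\<lambda>u v. (u \<bullet> x $ i) * (v \<bullet> y $ j))" by (rule bounded_bilinear_inner_mult)
    from square_integrable_bilinear[OF this Zi Zi] show ?thesis .
  qed
  have "(\<integral>\<omega>. ((Z \<omega> - ?m) \<bullet> x) * ((Z \<omega> - ?m) \<bullet> y) \<partial>M)
      = (\<integral>\<omega>. (Z \<omega> \<bullet> x) * (Z \<omega> \<bullet> y) \<partial>M) - (?m \<bullet> x) * (?m \<bullet> y)"
    by (rule bilinear_covariance[OF bounded_bilinear_inner_mult Z Z])
  also have "(\<integral>\<omega>. (Z \<omega> \<bullet> x) * (Z \<omega> \<bullet> y) \<partial>M)
      = (\<Sum>i\<in>UNIV. \<Sum>j\<in>UNIV. \<integral>\<omega>. (Z \<omega> $ i \<bullet> x $ i) * (Z \<omega> $ j \<bullet> y $ j) \<partial>M)"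
    unfolding inner_vec_def sum_product using int by simp
  also have "(?m \<bullet> x) * (?m \<bullet> y) = (\<Sum>i\<in>UNIV. \<Sum>j\<in>UNIV.
      ((\<integral>\<omega>. Z \<omega> $ i \<partial>M) \<bullet> x $ i) * ((\<integral>\<omega>. Z \<omega> $ j \<partial>M) \<bullet> y $ j))"
    unfolding inner_vec_def sum_product by (simp only: integral_vec_nth[OF square_integrable_integrable[OF Z]])
  finally show ?thesis by (simp only: sum_subtractf)
qed

section \<open>Freezing the time change\<close>

locale time_changed_levy = prob_space M for M :: "'w measure" +
  fixes Ls :: "'d :: finite \<Rightarrow> real \<Rightarrow> 'w \<Rightarrow> 'a :: {real_inner, banach, second_countable_topology}"
    and \<Theta> :: "real \<Rightarrow> 'w \<Rightarrow> real ^ 'd"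
  assumes Ls_levy: "\<And>j. levy_process M (Ls j)" and Ls_cadlag: "\<And>j. cadlag_process M (Ls j)"
    and Ls_indep: "indep_sets (\<lambda>j. process_events M (Ls j)) UNIV"
    and \<Theta>_measurable: "\<And>t. 0 \<le> t \<Longrightarrow> \<Theta> t \<in> borel_measurable M"
    and \<Theta>_cadlag: "cadlag_process M \<Theta>"
    and \<Theta>_nonneg: "\<And>t \<omega> j. 0 \<le> t \<Longrightarrow> \<omega> \<in> space M \<Longrightarrow> 0 \<le> \<Theta> t \<omega> $ j"
    and \<Theta>_Ls_indep: "indep_set (process_events M \<Theta>) (process_events M (joint_process Ls))"
begin

abbreviation X :: "'d \<Rightarrow> real \<Rightarrow> 'w \<Rightarrow> 'a" where
  "X j t \<equiv> (\<lambda>\<omega>. Ls j (\<Theta> t \<omega> $ j) \<omega>)"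

lemma Ls_right_continuous:
  "\<omega> \<in> space M \<Longrightarrow> 0 \<le> t \<Longrightarrow> ((\<lambda>s. Ls j s \<omega>) \<longlongrightarrow> Ls j t \<omega>) (at_right t)"
  using Ls_cadlag[of j] unfolding cadlag_process_def by blast

lemma \<Theta>_right_continuous:
  "\<omega> \<in> space M \<Longrightarrow> 0 \<le> t \<Longrightarrow> ((\<lambda>s. \<Theta> s \<omega> $ j) \<longlongrightarrow> \<Theta> t \<omega> $ j) (at_right t)"
  using \<Theta>_cadlag unfolding cadlag_process_def by (intro tendsto_vec_nth) blast

lemma \<Theta>_nth_measurable: "0 \<le> t \<Longrightarrow> (\<lambda>\<omega>. \<Theta> t \<omega> $ j) \<in> borel_measurable M"
  by (rule measurable_compose[OF \<Theta>_measurable vec_nth_measurable])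

lemma random_time_measurable:
  assumes t: "0 \<le> t"
  shows "(\<lambda>z. Ls j (\<Theta> t (fst z) $ j) (snd z)) \<in>
    borel_measurable (process_algebra M \<Theta> \<Otimes>\<^sub>M process_algebra M (joint_process Ls))"
proof (rule right_continuous_random_time_measurable)
  fix s :: real assume "0 \<le> s"
  from measurable_compose[OF measurable_process_algebra[OF this, where M = M and Y = "joint_process Ls"]
      vec_nth_measurable[of j]]
  show "Ls j s \<in> borel_measurable (process_algebra M (joint_process Ls))"
    by (simp only: joint_process_def vec_lambda_beta)
next
  show "(\<lambda>\<omega>. \<Theta> t \<omega> $ j) \<in> borel_measurable (process_algebra M \<Theta>)"
    by (rule measurable_compose[OF measurable_process_algebra[OF t] vec_nth_measurable])
qed (simp_all add: Ls_right_continuous \<Theta>_nonneg t)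

lemmas \<Theta>_Ls_indep_var = indep_process_events_imp_indep_var[OF \<Theta>_Ls_indep]

lemma X_measurable:
  assumes t: "0 \<le> t" shows "X j t \<in> borel_measurable M"
  using measurable_compose[OF measurable_Pair[OF indep_var_rv1[OF \<Theta>_Ls_indep_var]
        indep_var_rv2[OF \<Theta>_Ls_indep_var]] random_time_measurable[OF t, of j]]
  by (simp only: fst_conv snd_conv)

lemma X_nn_integral:
  assumes t: "0 \<le> t"
  shows "(\<integral>\<^sup>+\<omega>. (norm (X j t \<omega>))\<^sup>2 \<partial>M) = (\<integral>\<^sup>+\<omega>'. \<integral>\<^sup>+\<omega>. (norm (Ls j (\<Theta> t \<omega>' $ j) \<omega>))\<^sup>2 \<partial>M \<partial>M)"
proof -
  have "(\<lambda>z. ennreal ((norm (Ls j (\<Theta> t (fst z) $ j) (snd z)))\<^sup>2)) \<in>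
    borel_measurable (process_algebra M \<Theta> \<Otimes>\<^sub>M process_algebra M (joint_process Ls))"
    using random_time_measurable[OF t, of j] by measurable
  from indep_var_nn_integral[OF \<Theta>_Ls_indep_var this] show ?thesis by (simp only: fst_conv snd_conv)
qed

lemma X_integral:
  assumes t: "0 \<le> t" and i: "integrable M (X j t)"
  shows "integral\<^sup>L M (X j t) = (\<integral>\<omega>'. \<integral>\<omega>. Ls j (\<Theta> t \<omega>' $ j) \<omega> \<partial>M \<partial>M)"
  using indep_var_integral[OF \<Theta>_Ls_indep_var random_time_measurable[OF t, of j]] i
  by (simp only: fst_conv snd_conv)

lemma X_integral_bilinear:
  fixes b :: "'a \<Rightarrow> 'a \<Rightarrow> real"
  assumes t: "0 \<le> t" and b: "bounded_bilinear b"
    and i: "square_integrable M (X i t)" and j: "square_integrable M (X j t)"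
  shows "(\<integral>\<omega>. b (X i t \<omega>) (X j t \<omega>) \<partial>M) =
    (\<integral>\<omega>'. \<integral>\<omega>. b (Ls i (\<Theta> t \<omega>' $ i) \<omega>) (Ls j (\<Theta> t \<omega>' $ j) \<omega>) \<partial>M \<partial>M)"
proof -
  have "continuous_on UNIV (\<lambda>z. b (fst z) (snd z))"
    by (rule bounded_bilinear.continuous_on[OF b]) (auto intro!: continuous_intros)
  then have "(\<lambda>z. b (Ls i (\<Theta> t (fst z) $ i) (snd z)) (Ls j (\<Theta> t (fst z) $ j) (snd z))) \<in>
    borel_measurable (process_algebra M \<Theta> \<Otimes>\<^sub>M process_algebra M (joint_process Ls))"
    by (rule borel_measurable_continuous_Pair[OF random_time_measurable[OF t] random_time_measurable[OF t]])
  from indep_var_integral[OF \<Theta>_Ls_indep_var this] square_integrable_bilinear[OF b i j]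
  show ?thesis by (simp only: fst_conv snd_conv)
qed

text \<open>
  For \<open>i \<noteq> j\<close> the second summand is 0 by independence, so the choice of the factor \<open>r\<close> is arbitrary
  there.  Keeping it gives one formula for all pairs of components.
\<close>

lemma Ls_cross_moment:
  fixes b :: "'a \<Rightarrow> 'a \<Rightarrow> real"
  assumes b: "bounded_bilinear b"
    and sq: "\<And>j t. 0 \<le> t \<Longrightarrow> square_integrable M (Ls j t)"
    and s: "0 \<le> s" "0 \<le> r" "i = j \<Longrightarrow> s = r"
  defines "m \<equiv> \<lambda>j. integral\<^sup>L M (Ls j 1)"
  shows "(\<integral>\<omega>. b (Ls i s \<omega>) (Ls j r \<omega>) \<partial>M) =
    (s * r) * b (m i) (m j) + r * ((\<integral>\<omega>. b (Ls i 1 \<omega>) (Ls j 1 \<omega>) \<partial>M) - b (m i) (m j))"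
proof (cases "i = j")
  case True
  have "(\<integral>\<omega>. b (Ls j r \<omega>) (Ls j r \<omega>) \<partial>M) =
    r\<^sup>2 * b (m j) (m j) + r * ((\<integral>\<omega>. b (Ls j 1 \<omega>) (Ls j 1 \<omega>) \<partial>M) - b (m j) (m j))"
    unfolding m_def by (rule levy_second_moment[OF Ls_levy _ s(2) b]) (rule sq)
  then show ?thesis using True s(3) by (simp only: power2_eq_square)
next
  case False
  have prod: "(\<integral>\<omega>. b (Ls i u \<omega>) (Ls j v \<omega>) \<partial>M) = b (integral\<^sup>L M (Ls i u)) (integral\<^sup>L M (Ls j v))"
    if u: "0 \<le> u" and v: "0 \<le> v" for u v
  proof -
    have "indep_var borel (Ls i u \<circ> (\<lambda>\<omega>. \<omega>)) borel (Ls j v \<circ> (\<lambda>\<omega>. \<omega>))"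
      using indep_process_events_imp_indep_var[OF indep_sets_imp_indep_set[OF Ls_indep UNIV_I UNIV_I False]]
        measurable_process_algebra[OF u] measurable_process_algebra[OF v]
      by (rule indep_var_compose)
    then show ?thesis
      using indep_var_bilinear_expectation[OF b sq[OF u, of i] sq[OF v, of j]] by (simp only: comp_def)
  qed
  have mean: "integral\<^sup>L M (Ls k u) = u *\<^sub>R m k" if "0 \<le> u" for k u
    unfolding m_def by (rule levy_mean_linear[OF Ls_levy _ that]) (rule sq)
  show ?thesis
    unfolding prod[OF s(1,2)] prod[OF zero_le_one zero_le_one] mean[OF s(1)] mean[OF s(2)]
    by (simp add: m_def bounded_bilinear.scaleR_left[OF b] bounded_bilinear.scaleR_right[OF b])
qed

lemma X_cross_moment:
  fixes b :: "'a \<Rightarrow> 'a \<Rightarrow> real"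
  assumes t: "0 \<le> t" and b: "bounded_bilinear b"
    and sq: "\<And>j t. 0 \<le> t \<Longrightarrow> square_integrable M (Ls j t)"
    and i: "square_integrable M (X i t)" and j: "square_integrable M (X j t)"
  defines "m \<equiv> \<lambda>j. integral\<^sup>L M (Ls j 1)"
  shows "(\<integral>\<omega>. b (X i t \<omega>) (X j t \<omega>) \<partial>M) =
    (\<integral>\<omega>. (\<Theta> t \<omega> $ i * \<Theta> t \<omega> $ j) * b (m i) (m j)
      + \<Theta> t \<omega> $ j * ((\<integral>\<omega>. b (Ls i 1 \<omega>) (Ls j 1 \<omega>) \<partial>M) - b (m i) (m j)) \<partial>M)"
  unfolding X_integral_bilinear[OF t b i j] m_def
proof (rule Bochner_Integration.integral_cong[OF refl])
  fix \<omega>' assume "\<omega>' \<in> space M"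
  note nn = \<Theta>_nonneg[OF t this]
  show "(\<integral>\<omega>. b (Ls i (\<Theta> t \<omega>' $ i) \<omega>) (Ls j (\<Theta> t \<omega>' $ j) \<omega>) \<partial>M) =
    (\<Theta> t \<omega>' $ i * \<Theta> t \<omega>' $ j) * b (integral\<^sup>L M (Ls i 1)) (integral\<^sup>L M (Ls j 1))
      + \<Theta> t \<omega>' $ j * ((\<integral>\<omega>. b (Ls i 1 \<omega>) (Ls j 1 \<omega>) \<partial>M)
        - b (integral\<^sup>L M (Ls i 1)) (integral\<^sup>L M (Ls j 1)))"
    by (rule Ls_cross_moment[OF b _ nn nn]) (use sq in auto)
qed

lemma X_mean:
  assumes t: "0 \<le> t" and sq: "\<And>t. 0 \<le> t \<Longrightarrow> square_integrable M (Ls j t)"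
    and i: "integrable M (X j t)" and \<Theta>: "integrable M (\<lambda>\<omega>. \<Theta> t \<omega> $ j)"
  shows "integral\<^sup>L M (X j t) = (\<integral>\<omega>. \<Theta> t \<omega> $ j \<partial>M) *\<^sub>R integral\<^sup>L M (Ls j 1)"
proof -
  have "integral\<^sup>L M (X j t) = (\<integral>\<omega>'. \<Theta> t \<omega>' $ j *\<^sub>R integral\<^sup>L M (Ls j 1) \<partial>M)"
    unfolding X_integral[OF t i]
  proof (rule Bochner_Integration.integral_cong[OF refl])
    fix \<omega>' assume "\<omega>' \<in> space M"
    note nn = \<Theta>_nonneg[OF t this]
    show "(\<integral>\<omega>. Ls j (\<Theta> t \<omega>' $ j) \<omega> \<partial>M) = \<Theta> t \<omega>' $ j *\<^sub>R integral\<^sup>L M (Ls j 1)"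
      by (rule levy_mean_linear[OF Ls_levy _ nn]) (rule sq)
  qed
  also have "\<dots> = (\<integral>\<omega>. \<Theta> t \<omega> $ j \<partial>M) *\<^sub>R integral\<^sup>L M (Ls j 1)"
    using \<Theta> by (intro integral_scaleR_left)
  finally show ?thesis .
qed

text \<open>
  The integral of \<open>E |L\<^sub>j(s)|\<^sup>2\<close> against the law of \<open>\<Theta>\<^sub>j(u)\<close> is finite.  If this law is not concentrated
  at 0, then \<open>L\<^sub>j(s)\<close> is square integrable for at least one \<open>s > 0\<close>.
\<close>

lemma Ls_square_integrable_if_X:
  assumes sq: "\<And>t. 0 \<le> t \<Longrightarrow> square_integrable M (X j t)"
    and nz: "\<not> zero_process M (\<lambda>t \<omega>. \<Theta> t \<omega> $ j)" and t: "0 \<le> t"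
  shows "square_integrable M (Ls j t)"
proof -
  obtain u where u: "0 \<le> u" "\<not> (AE \<omega> in M. \<Theta> u \<omega> $ j = 0)"
    using right_continuous_zero_process[of M "\<lambda>t \<omega>. \<Theta> t \<omega> $ j"] \<Theta>_right_continuous nz by blast
  define g where "g s = (\<integral>\<^sup>+\<omega>. (norm (Ls j s \<omega>))\<^sup>2 \<partial>M)" for s
  have "(\<integral>\<^sup>+\<omega>. (norm (X j u \<omega>))\<^sup>2 \<partial>M) < \<infinity>"
    using sq[OF u(1)] by (simp add: square_integrable_def integrable_iff_bounded)
  then have fin: "(\<integral>\<^sup>+\<omega>. g (\<Theta> u \<omega> $ j) \<partial>M) \<noteq> \<infinity>"
    using X_nn_integral[OF u(1), of j] by (simp add: g_def)
  \<comment> \<open>joint measurability makes the inner integral a measurable function of \<open>\<omega>\<close>, as the passage from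
      a finite integral to finite values requires\<close>
  have "(\<lambda>z. Ls j (\<Theta> u (fst z) $ j) (snd z)) \<in> borel_measurable (M \<Otimes>\<^sub>M M)"
    by (rule right_continuous_random_time_measurable)
      (simp_all add: levy_process_measurable[OF Ls_levy] Ls_right_continuous \<Theta>_nth_measurable \<Theta>_nonneg u(1))
  then have "(\<lambda>z. ennreal ((norm (Ls j (\<Theta> u (fst z) $ j) (snd z)))\<^sup>2)) \<in> borel_measurable (M \<Otimes>\<^sub>M M)"
    by measurable
  from borel_measurable_nn_integral_fst[OF this]
  have "(\<lambda>\<omega>. g (\<Theta> u \<omega> $ j)) \<in> borel_measurable M" by (simp only: g_def fst_conv snd_conv)
  then have AE: "AE \<omega> in M. g (\<Theta> u \<omega> $ j) \<noteq> \<infinity>" using fin by (rule nn_integral_PInf_AE)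
  have "\<exists>\<omega>\<in>space M. \<Theta> u \<omega> $ j \<noteq> 0 \<and> g (\<Theta> u \<omega> $ j) < \<infinity>"
  proof (rule ccontr)
    assume no: "\<not> ?thesis"
    have "AE \<omega> in M. \<Theta> u \<omega> $ j = 0"
      by (rule AE_mp[OF AE], rule AE_I2) (use no in \<open>auto simp: less_top\<close>)
    then show False using u(2) by blast
  qed
  then obtain \<omega> where w: "\<omega> \<in> space M" "\<Theta> u \<omega> $ j \<noteq> 0" "g (\<Theta> u \<omega> $ j) < \<infinity>" by blast
  define s where "s = \<Theta> u \<omega> $ j"
  have s: "0 < s" using w \<Theta>_nonneg[OF u(1) w(1), of j] by (simp add: s_def)
  have "square_integrable M (Ls j s)"
    using w(3) levy_process_measurable[OF Ls_levy, of s j] s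
    by (simp add: square_integrable_def integrable_iff_bounded g_def s_def)
  then show ?thesis using levy_square_integrable_all_times[OF Ls_levy s _ t] by blast
qed

section \<open>Square integrability of the time-changed components\<close>

definition Ls_variance :: "'d \<Rightarrow> real" where
  "Ls_variance j = (\<integral>\<omega>. Ls j 1 \<omega> \<bullet> Ls j 1 \<omega> \<partial>M) - integral\<^sup>L M (Ls j 1) \<bullet> integral\<^sup>L M (Ls j 1)"

lemma Ls_variance_nonneg:
  assumes sq: "square_integrable M (Ls j 1)"
  shows "0 \<le> Ls_variance j"
proof -
  have "Ls_variance j = (\<integral>\<omega>. (Ls j 1 \<omega> - integral\<^sup>L M (Ls j 1)) \<bullet> (Ls j 1 \<omega> - integral\<^sup>L M (Ls j 1)) \<partial>M)"
    unfolding Ls_variance_def by (rule bilinear_covariance[OF bounded_bilinear_inner sq sq, symmetric])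
  then show ?thesis by simp
qed

lemma Ls_norm_moment:
  assumes sq: "\<And>t. 0 \<le> t \<Longrightarrow> square_integrable M (Ls j t)" and s: "0 \<le> s"
  shows "(\<integral>\<omega>. (norm (Ls j s \<omega>))\<^sup>2 \<partial>M) = s\<^sup>2 * (norm (integral\<^sup>L M (Ls j 1)))\<^sup>2 + s * Ls_variance j"
  unfolding power2_norm_eq_inner Ls_variance_def
  by (rule levy_second_moment[OF Ls_levy _ s bounded_bilinear_inner]) (rule sq)

lemma X_square_integrable_iff:
  assumes sq: "\<And>t. 0 \<le> t \<Longrightarrow> square_integrable M (Ls j t)" and t: "0 \<le> t"
  shows "square_integrable M (X j t) \<longleftrightarrow>
    integrable M (\<lambda>\<omega>. (\<Theta> t \<omega> $ j)\<^sup>2 * (norm (integral\<^sup>L M (Ls j 1)))\<^sup>2 + \<Theta> t \<omega> $ j * Ls_variance j)"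
    (is "_ \<longleftrightarrow> integrable M ?q")
proof -
  have q: "?q \<in> borel_measurable M" using \<Theta>_nth_measurable[OF t, of j] by measurable
  have q0: "0 \<le> ?q \<omega>" if "\<omega> \<in> space M" for \<omega>
    using \<Theta>_nonneg[OF t that, of j] Ls_variance_nonneg[OF sq[OF zero_le_one]] by simp
  have "(\<integral>\<^sup>+\<omega>. (norm (X j t \<omega>))\<^sup>2 \<partial>M) = (\<integral>\<^sup>+\<omega>. norm (?q \<omega>) \<partial>M)"
    unfolding X_nn_integral[OF t]
  proof (rule nn_integral_cong)
    fix \<omega>' assume w: "\<omega>' \<in> space M"
    note nn = \<Theta>_nonneg[OF t w, of j]
    have "(\<integral>\<^sup>+\<omega>. (norm (Ls j (\<Theta> t \<omega>' $ j) \<omega>))\<^sup>2 \<partial>M) = ennreal (\<integral>\<omega>. (norm (Ls j (\<Theta> t \<omega>' $ j) \<omega>))\<^sup>2 \<partial>M)"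
      using sq[OF nn] by (intro nn_integral_eq_integral) (auto simp: square_integrable_def)
    also have "\<dots> = ennreal (?q \<omega>')" by (simp only: Ls_norm_moment[OF sq nn])
    finally show "(\<integral>\<^sup>+\<omega>. (norm (Ls j (\<Theta> t \<omega>' $ j) \<omega>))\<^sup>2 \<partial>M) = ennreal (norm (?q \<omega>'))"
      using q0[OF w] by simp
  qed
  moreover have "square_integrable M (X j t) \<longleftrightarrow> (\<integral>\<^sup>+\<omega>. (norm (X j t \<omega>))\<^sup>2 \<partial>M) < \<infinity>"
    using X_measurable[OF t, of j] by (simp add: square_integrable_def integrable_iff_bounded)
  moreover have "integrable M ?q \<longleftrightarrow> (\<integral>\<^sup>+\<omega>. norm (?q \<omega>) \<partial>M) < \<infinity>"
    using q by (simp only: integrable_iff_bounded simp_thms)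
  ultimately show ?thesis by (simp only:)
qed

lemma \<Theta>_square_integrable_iff:
  "0 \<le> t \<Longrightarrow> square_integrable M (\<lambda>\<omega>. \<Theta> t \<omega> $ j) \<longleftrightarrow> integrable M (\<lambda>\<omega>. (\<Theta> t \<omega> $ j)\<^sup>2)"
  by (simp add: square_integrable_def \<Theta>_nth_measurable)

lemma Ls_mean_zero_iff:
  assumes sq: "\<And>t. 0 \<le> t \<Longrightarrow> square_integrable M (Ls j t)"
  shows "mean_zero_process M (Ls j) \<longleftrightarrow> integral\<^sup>L M (Ls j 1) = 0"
proof -
  have mean: "integral\<^sup>L M (Ls j t) = t *\<^sub>R integral\<^sup>L M (Ls j 1)" if "0 \<le> t" for t
    by (rule levy_mean_linear[OF Ls_levy _ that]) (rule sq)
  have "integrable_process M (Ls j)"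
    unfolding integrable_process_def using square_integrable_integrable[OF sq] by blast
  moreover have "integral\<^sup>L M (Ls j t) = 0" if "integral\<^sup>L M (Ls j 1) = 0" "0 \<le> t" for t
    using mean[OF that(2)] by (simp only: that(1) scaleR_zero_right)
  ultimately show ?thesis
    unfolding mean_zero_process_def using zero_le_one[where 'a = real] by blast
qed

text \<open>
  The integrand \<open>\<theta>\<^sup>2 |m|\<^sup>2 + \<theta> c\<close> dominates each of its two summands, so its integrability controls
  \<open>\<Theta>\<^sub>j\<^sup>2\<close> when \<open>m \<noteq> 0\<close> and \<open>\<Theta>\<^sub>j\<close> when \<open>m = 0 \<noteq> c\<close>.  When both coefficients vanish, so does
  the second moment of \<open>L\<^sub>j\<close> at every time.
\<close>

lemma X_square_integrable_imp_cases:
  assumes sq: "\<And>t. 0 \<le> t \<Longrightarrow> square_integrable M (Ls j t)"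
    and X: "\<And>t. 0 \<le> t \<Longrightarrow> square_integrable M (X j t)"
  shows "square_integrable_process M (\<lambda>t \<omega>. \<Theta> t \<omega> $ j) \<or>
    (mean_zero_process M (Ls j) \<and> integrable_process M (\<lambda>t \<omega>. \<Theta> t \<omega> $ j)) \<or>
    zero_process M (Ls j)"
proof -
  define m where "m = integral\<^sup>L M (Ls j 1)"
  define c where "c = Ls_variance j"
  have c: "0 \<le> c" unfolding c_def by (rule Ls_variance_nonneg[OF sq[OF zero_le_one]])
  have int: "integrable M (\<lambda>\<omega>. (\<Theta> t \<omega> $ j)\<^sup>2 * (norm m)\<^sup>2 + \<Theta> t \<omega> $ j * c)" if "0 \<le> t" for t
    using X_square_integrable_iff[OF sq that] X[OF that] by (simp only: m_def c_def)
  consider "m \<noteq> 0" | "m = 0" "c \<noteq> 0" | "m = 0" "c = 0" by blast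
  then show ?thesis
  proof cases
    case 1
    have "square_integrable M (\<lambda>\<omega>. \<Theta> t \<omega> $ j)" if t: "0 \<le> t" for t
    proof -
      have "integrable M (\<lambda>\<omega>. (\<Theta> t \<omega> $ j)\<^sup>2 * (norm m)\<^sup>2)"
      proof (rule Bochner_Integration.integrable_bound[OF int[OF t]])
        show "(\<lambda>\<omega>. (\<Theta> t \<omega> $ j)\<^sup>2 * (norm m)\<^sup>2) \<in> borel_measurable M"
          using \<Theta>_nth_measurable[OF t, of j] by measurable
        show "AE \<omega> in M. norm ((\<Theta> t \<omega> $ j)\<^sup>2 * (norm m)\<^sup>2)
            \<le> norm ((\<Theta> t \<omega> $ j)\<^sup>2 * (norm m)\<^sup>2 + \<Theta> t \<omega> $ j * c)"
          using \<Theta>_nonneg[OF t] c by (intro AE_I2) simp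
      qed
      then have "integrable M (\<lambda>\<omega>. (\<Theta> t \<omega> $ j)\<^sup>2)" using 1 by (simp add: integrable_mult_left_iff)
      then show ?thesis using \<Theta>_square_integrable_iff[OF t] by blast
    qed
    then show ?thesis unfolding square_integrable_process_iff by blast
  next
    case 2
    then have "integrable M (\<lambda>\<omega>. \<Theta> t \<omega> $ j)" if "0 \<le> t" for t
      using int[OF that] by simp
    then show ?thesis
      using 2(1) Ls_mean_zero_iff[OF sq] unfolding integrable_process_def m_def by blast
  next
    case 3
    have "AE \<omega> in M. Ls j t \<omega> = 0" if t: "0 \<le> t" for t
    proof -
      have i: "integrable M (\<lambda>\<omega>. (norm (Ls j t \<omega>))\<^sup>2)" using sq[OF t] by (simp add: square_integrable_def)
      have "(\<integral>\<omega>. (norm (Ls j t \<omega>))\<^sup>2 \<partial>M) = 0"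
        using Ls_norm_moment[OF sq t] 3 by (simp add: m_def c_def)
      then show ?thesis using integral_nonneg_eq_0_iff_AE[OF i] by simp
    qed
    then show ?thesis using right_continuous_zero_process[of M "Ls j"] Ls_right_continuous by blast
  qed
qed

lemma X_zero:
  assumes t: "0 \<le> t" and z: "zero_process M (\<lambda>t \<omega>. \<Theta> t \<omega> $ j) \<or> zero_process M (Ls j)"
  shows "square_integrable M (X j t)" "integral\<^sup>L M (X j t) = 0"
proof -
  have "AE \<omega> in M. X j t \<omega> = 0"
    using z
  proof
    assume "zero_process M (\<lambda>t \<omega>. \<Theta> t \<omega> $ j)"
    then have "AE \<omega> in M. \<forall>t\<ge>0. \<Theta> t \<omega> $ j = 0" by (simp only: zero_process_def)
    then show ?thesis
      using levy_process_0[OF Ls_levy[of j]]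
      by (rule AE_mp[OF AE_conjI]) (use t in \<open>auto intro!: AE_I2\<close>)
  next
    assume "zero_process M (Ls j)"
    then have "AE \<omega> in M. \<forall>t\<ge>0. Ls j t \<omega> = 0" by (simp only: zero_process_def)
    then show ?thesis by (rule AE_mp) (use t \<Theta>_nonneg in \<open>auto intro!: AE_I2\<close>)
  qed
  then have AE: "AE \<omega> in M. X j t \<omega> = 0" .
  show "integral\<^sup>L M (X j t) = 0" using AE by (rule integral_eq_zero_AE)
  have "AE \<omega> in M. (norm (X j t \<omega>))\<^sup>2 = 0" using AE by (rule AE_mp) (auto intro!: AE_I2)
  then have "integrable M (\<lambda>\<omega>. (norm (X j t \<omega>))\<^sup>2) = integrable M (\<lambda>\<omega>. 0 :: real)"
    using X_measurable[OF t, of j] by (intro integrable_cong_AE) auto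
  then show "square_integrable M (X j t)" using X_measurable[OF t, of j] by (simp add: square_integrable_def)
qed

lemma X_square_integrable_if_square_integrable:
  assumes L: "square_integrable_process M (Ls j)" and \<Theta>: "square_integrable_process M (\<lambda>t \<omega>. \<Theta> t \<omega> $ j)"
    and t: "0 \<le> t"
  shows "square_integrable M (X j t)"
proof -
  have sq: "square_integrable M (Ls j t)" if "0 \<le> t" for t
    using L that by (simp add: square_integrable_process_iff)
  have \<Theta>t: "square_integrable M (\<lambda>\<omega>. \<Theta> t \<omega> $ j)" using \<Theta> t by (simp add: square_integrable_process_iff)
  then have "integrable M (\<lambda>\<omega>. (\<Theta> t \<omega> $ j)\<^sup>2)" "integrable M (\<lambda>\<omega>. \<Theta> t \<omega> $ j)"
    using \<Theta>_square_integrable_iff[OF t] square_integrable_integrable[OF \<Theta>t] by blast+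
  then show ?thesis by (subst X_square_integrable_iff[OF sq t]) simp_all
qed

lemma X_square_integrable_if_mean_zero:
  assumes L: "square_integrable_process M (Ls j)" "mean_zero_process M (Ls j)"
    and \<Theta>: "integrable_process M (\<lambda>t \<omega>. \<Theta> t \<omega> $ j)" and t: "0 \<le> t"
  shows "square_integrable M (X j t)" "integral\<^sup>L M (X j t) = 0"
proof -
  have sq: "square_integrable M (Ls j t)" if "0 \<le> t" for t
    using L that by (simp add: square_integrable_process_iff)
  have \<Theta>t: "integrable M (\<lambda>\<omega>. \<Theta> t \<omega> $ j)" using \<Theta> t by (simp add: integrable_process_def)
  have m: "integral\<^sup>L M (Ls j 1) = 0" using L(2) Ls_mean_zero_iff[OF sq] by blast
  show X: "square_integrable M (X j t)"
    using \<Theta>t by (subst X_square_integrable_iff[OF sq t]) (simp_all add: m)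
  show "integral\<^sup>L M (X j t) = 0"
    using X_mean[OF t sq square_integrable_integrable[OF X] \<Theta>t] m by simp
qed

lemma X_square_integrable_process_iff:
  "square_integrable_process M (X j) \<longleftrightarrow>
     (square_integrable_process M (Ls j) \<and> square_integrable_process M (\<lambda>t \<omega>. \<Theta> t \<omega> $ j)) \<or>
     (mean_zero_process M (Ls j) \<and> square_integrable_process M (Ls j) \<and>
        integrable_process M (\<lambda>t \<omega>. \<Theta> t \<omega> $ j)) \<or>
     zero_process M (\<lambda>t \<omega>. \<Theta> t \<omega> $ j) \<or> zero_process M (Ls j)" (is "?X \<longleftrightarrow> ?cases")
proof
  assume X: ?X
  then have Xt: "square_integrable M (X j t)" if "0 \<le> t" for t
    using that by (simp only: square_integrable_process_iff)
  show ?cases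
  proof (cases "zero_process M (\<lambda>t \<omega>. \<Theta> t \<omega> $ j)")
    case False
    have sq: "square_integrable M (Ls j t)" if "0 \<le> t" for t
      using Xt False that by (rule Ls_square_integrable_if_X)
    then have "square_integrable_process M (Ls j)" unfolding square_integrable_process_iff by blast
    then show ?thesis using X_square_integrable_imp_cases[OF sq Xt] by blast
  qed blast
next
  assume ?cases
  then have "square_integrable M (X j t)" if "0 \<le> t" for t
    using that X_square_integrable_if_square_integrable X_square_integrable_if_mean_zero(1) X_zero(1) by blast
  then show ?X unfolding square_integrable_process_iff by blast
qed

text \<open>
  The mean of \<open>X\<^sub>j(t)\<close> is the mean of \<open>\<Theta>\<^sub>j(t)\<close> times that of \<open>L\<^sub>j(1)\<close>.  If it vanishes while \<open>L\<^sub>j\<close> is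
  not mean zero, then the nonnegative variables \<open>\<Theta>\<^sub>j(t)\<close> have mean 0 and hence are 0 almost surely.
\<close>

lemma X_mean_zero_square_integrable_process_iff:
  "mean_zero_process M (X j) \<and> square_integrable_process M (X j) \<longleftrightarrow>
     (mean_zero_process M (Ls j) \<and> square_integrable_process M (Ls j) \<and>
        integrable_process M (\<lambda>t \<omega>. \<Theta> t \<omega> $ j)) \<or>
     zero_process M (\<lambda>t \<omega>. \<Theta> t \<omega> $ j) \<or> zero_process M (Ls j)" (is "?X \<longleftrightarrow> ?cases")
proof
  assume X: ?X
  show ?cases
  proof (rule ccontr)
    assume no: "\<not> ?cases"
    then have L: "square_integrable_process M (Ls j)"
      and \<Theta>: "square_integrable_process M (\<lambda>t \<omega>. \<Theta> t \<omega> $ j)"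
      using X X_square_integrable_process_iff[of j] by blast+
    have sq: "square_integrable M (Ls j t)" if "0 \<le> t" for t
      using L that by (simp add: square_integrable_process_iff)
    have \<Theta>i: "integrable M (\<lambda>\<omega>. \<Theta> t \<omega> $ j)" if "0 \<le> t" for t
      using \<Theta> that by (intro square_integrable_integrable) (simp add: square_integrable_process_iff)
    then have "\<not> mean_zero_process M (Ls j)"
      using no L unfolding integrable_process_def by blast
    then have m: "integral\<^sup>L M (Ls j 1) \<noteq> 0" using Ls_mean_zero_iff[OF sq] by blast
    have "AE \<omega> in M. \<Theta> t \<omega> $ j = 0" if t: "0 \<le> t" for t
    proof -
      have Xi: "integrable M (X j t)" "integral\<^sup>L M (X j t) = 0"
        using X t unfolding mean_zero_process_def integrable_process_def by blast+
      then have "(\<integral>\<omega>. \<Theta> t \<omega> $ j \<partial>M) = 0" using X_mean[OF t sq Xi(1) \<Theta>i[OF t]] m by simp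
      moreover have "AE \<omega> in M. 0 \<le> \<Theta> t \<omega> $ j" by (rule AE_I2) (rule \<Theta>_nonneg[OF t])
      ultimately show ?thesis using integral_nonneg_eq_0_iff_AE[OF \<Theta>i[OF t]] by blast
    qed
    then have "zero_process M (\<lambda>t \<omega>. \<Theta> t \<omega> $ j)"
      using right_continuous_zero_process[of M "\<lambda>t \<omega>. \<Theta> t \<omega> $ j"] \<Theta>_right_continuous by blast
    then show False using no by blast
  qed
next
  assume c: ?cases
  then have "integral\<^sup>L M (X j t) = 0" if "0 \<le> t" for t
    using that X_square_integrable_if_mean_zero(2) X_zero(2) by blast
  moreover have sq: "square_integrable_process M (X j)"
    using c X_square_integrable_process_iff[of j] by blast
  moreover have "integrable M (X j t)" if "0 \<le> t" for t
    using sq that by (intro square_integrable_integrable) (simp add: square_integrable_process_iff)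
  ultimately show ?X unfolding mean_zero_process_def integrable_process_def by blast
qed

end

section \<open>Mean and covariance operator\<close>

lemma subspace_prod_space: "(\<And>j. subspace (Hs j)) \<Longrightarrow> subspace (prod_space Hs)"
  unfolding subspace_def prod_space_def by simp

lemma closed_prod_space:
  fixes Hs :: "'d :: finite \<Rightarrow> 'b :: real_normed_vector set"
  assumes "\<And>j. closed (Hs j)"
  shows "closed (prod_space Hs)"
proof -
  have "prod_space Hs = (\<Inter>j. (\<lambda>u. u $ j) -` Hs j)" by (auto simp: prod_space_def)
  moreover have "closed ((\<lambda>u :: 'b ^ 'd. u $ j) -` Hs j)" for j
    by (rule closed_vimage[OF assms]) (rule linear_continuous_on[OF bounded_linear_vec_nth])
  ultimately show ?thesis by (auto intro: closed_INT)
qed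

lemma axis_in_prod_space:
  "(\<And>j. subspace (Hs j)) \<Longrightarrow> u \<in> Hs i \<Longrightarrow> axis i u \<in> prod_space Hs"
  by (auto simp: prod_space_def axis_def subspace_0)

lemma coord_scale_in_prod_space:
  "(\<And>j. subspace (Hs j)) \<Longrightarrow> u \<in> prod_space Hs \<Longrightarrow> coord_scale a u \<in> prod_space Hs"
  by (auto simp: prod_space_def coord_scale_def subspace_scale)

lemma inner_coord_scale: "coord_scale a u \<bullet> v = u \<bullet> coord_scale a v"
  by (simp add: inner_vec_def coord_scale_def)

lemma integrable_vec:
  fixes Z :: "'w \<Rightarrow> 'b :: {banach, second_countable_topology} ^ 'd"
  assumes "\<And>i. integrable M (\<lambda>\<omega>. Z \<omega> $ i)"
  shows "integrable M Z"
proof -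
  have "integrable M (\<lambda>\<omega>. \<Sum>i\<in>UNIV. axis i (Z \<omega> $ i) :: 'b ^ 'd)"
    by (intro Bochner_Integration.integrable_sum integrable_bounded_linear[OF bounded_linear_axis] assms)
  then show ?thesis by (simp only: vec_eq_sum_axis[symmetric])
qed

lemma eq_if_inner_eq_on_subspace:
  assumes "subspace V" "u \<in> V" "v \<in> V" "\<And>y. y \<in> V \<Longrightarrow> u \<bullet> y = v \<bullet> y"
  shows "u = v"
proof -
  have "(u - v) \<bullet> (u - v) = 0"
    using assms(4)[OF subspace_diff[OF assms(1-3)]] by (simp only: inner_diff_left) 
  then show ?thesis by simp
qed

lemma (in prob_space)
  assumes V: "subspace V" "closed V" and Y: "square_integrable M Y" "\<And>\<omega>. \<omega> \<in> space M \<Longrightarrow> Y \<omega> \<in> V"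
    and x: "x \<in> V"
  shows cov_op_in_subspace: "cov_op M V Y x \<in> V"
    and cov_op_inner: "y \<in> V \<Longrightarrow> cov_op M V Y x \<bullet> y =
      (\<integral>\<omega>. ((Y \<omega> - integral\<^sup>L M Y) \<bullet> x) * ((Y \<omega> - integral\<^sup>L M Y) \<bullet> y) \<partial>M)"
proof -
  have Y': "Y \<in> borel_measurable M" "integrable M (\<lambda>\<omega>. (norm (Y \<omega>))\<^sup>2)"
    using Y(1) by (auto simp: square_integrable_def)
  have T: "cov_op M V Y \<in> V \<rightarrow>\<^sub>E V \<and>
        (\<forall>x\<in>V. \<forall>y\<in>V. cov_op M V Y x \<bullet> y =
           (\<integral>\<omega>. ((Y \<omega> - integral\<^sup>L M Y) \<bullet> x) * ((Y \<omega> - integral\<^sup>L M Y) \<bullet> y) \<partial>M))"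
    unfolding cov_op_def by (rule theI'[OF cov_op_exists_unique[OF prob_space_axioms V Y' Y(2)]])
  show "cov_op M V Y x \<in> V" using T x by blast
  show "cov_op M V Y x \<bullet> y =
      (\<integral>\<omega>. ((Y \<omega> - integral\<^sup>L M Y) \<bullet> x) * ((Y \<omega> - integral\<^sup>L M Y) \<bullet> y) \<partial>M)" if "y \<in> V"
    using T x that by blast
qed

context time_changed_levy
begin

lemma subordinated_nth: "subordinated Ls \<Theta> t \<omega> $ j = X j t \<omega>"
  by (simp add: subordinated_def multiparameter_def)

lemma subordinated_mean:
  assumes sq: "\<And>j t. 0 \<le> t \<Longrightarrow> square_integrable M (Ls j t)"
    and X: "\<And>j. square_integrable M (X j 1)"
    and \<Theta>: "\<And>j. integrable M (\<lambda>\<omega>. \<Theta> 1 \<omega> $ j)"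
  shows "integral\<^sup>L M (subordinated Ls \<Theta> 1) =
    coord_scale (integral\<^sup>L M (\<Theta> 1)) (integral\<^sup>L M (joint_process Ls 1))"
proof -
  have iX: "integrable M (subordinated Ls \<Theta> 1)"
    by (rule integrable_vec) (simp only: subordinated_nth square_integrable_integrable[OF X])
  have iL: "integrable M (joint_process Ls 1)"
    by (rule integrable_vec) (simp add: joint_process_def square_integrable_integrable sq)
  have "integral\<^sup>L M (subordinated Ls \<Theta> 1) $ j =
      coord_scale (integral\<^sup>L M (\<Theta> 1)) (integral\<^sup>L M (joint_process Ls 1)) $ j" for j
  proof -
    have "integral\<^sup>L M (X j 1) = (\<integral>\<omega>. \<Theta> 1 \<omega> $ j \<partial>M) *\<^sub>R integral\<^sup>L M (Ls j 1)"
      by (rule X_mean[OF zero_le_one sq square_integrable_integrable[OF X] \<Theta>])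
    then show ?thesis
      by (simp add: integral_vec_nth[OF iX] integral_vec_nth[OF iL] integral_vec_nth[OF integrable_vec[OF \<Theta>]]
          coord_scale_def subordinated_nth joint_process_def)
  qed
  then show ?thesis by (simp add: vec_eq_iff)
qed

text \<open>
  When all means of \<open>L(1)\<close> vanish, \<open>cov_entry\<close> is multiplied by 0.  The formula then also holds if the
  products \<open>\<Theta>\<^sub>i(1) \<Theta>\<^sub>j(1)\<close> are not integrable and \<open>cov_entry\<close> has only a default value, which lets
  one formula cover both cases.
\<close>

lemma X_covariance_entry:
  fixes b :: "'a \<Rightarrow> 'a \<Rightarrow> real"
  assumes b: "bounded_bilinear b"
    and sq: "\<And>j t. 0 \<le> t \<Longrightarrow> square_integrable M (Ls j t)"
    and X: "\<And>j. square_integrable M (X j 1)"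
    and \<Theta>: "\<And>j. integrable M (\<lambda>\<omega>. \<Theta> 1 \<omega> $ j)"
    and cases: "(\<forall>j. square_integrable M (\<lambda>\<omega>. \<Theta> 1 \<omega> $ j)) \<or> (\<forall>j. integral\<^sup>L M (Ls j 1) = 0)"
  defines "m \<equiv> \<lambda>j. integral\<^sup>L M (Ls j 1)"
  shows "(\<integral>\<omega>. b (X i 1 \<omega>) (X j 1 \<omega>) \<partial>M) - b (integral\<^sup>L M (X i 1)) (integral\<^sup>L M (X j 1)) =
    cov_entry M (\<Theta> 1) i j * b (m i) (m j)
      + (\<integral>\<omega>. \<Theta> 1 \<omega> $ j \<partial>M) * ((\<integral>\<omega>. b (Ls i 1 \<omega>) (Ls j 1 \<omega>) \<partial>M) - b (m i) (m j))"
proof -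
  define C where "C = (\<integral>\<omega>. b (Ls i 1 \<omega>) (Ls j 1 \<omega>) \<partial>M) - b (m i) (m j)"
  have mom: "(\<integral>\<omega>. b (X i 1 \<omega>) (X j 1 \<omega>) \<partial>M) =
      (\<integral>\<omega>. (\<Theta> 1 \<omega> $ i * \<Theta> 1 \<omega> $ j) * b (m i) (m j) + \<Theta> 1 \<omega> $ j * C \<partial>M)"
    unfolding m_def C_def by (rule X_cross_moment[OF zero_le_one b sq X X])
  have mean: "integral\<^sup>L M (X j 1) = (\<integral>\<omega>. \<Theta> 1 \<omega> $ j \<partial>M) *\<^sub>R m j" for j
    unfolding m_def by (rule X_mean[OF zero_le_one sq square_integrable_integrable[OF X] \<Theta>])
  have mm: "b (integral\<^sup>L M (X i 1)) (integral\<^sup>L M (X j 1)) =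
      ((\<integral>\<omega>. \<Theta> 1 \<omega> $ i \<partial>M) * (\<integral>\<omega>. \<Theta> 1 \<omega> $ j \<partial>M)) * b (m i) (m j)"
    unfolding mean by (simp add: bounded_bilinear.scaleR_left[OF b] bounded_bilinear.scaleR_right[OF b])
  from cases show ?thesis
  proof
    assume "\<forall>j. square_integrable M (\<lambda>\<omega>. \<Theta> 1 \<omega> $ j)"
    then have sq\<Theta>: "square_integrable M (\<lambda>\<omega>. \<Theta> 1 \<omega> $ j)" for j by blast
    have int: "integrable M (\<lambda>\<omega>. \<Theta> 1 \<omega> $ i * \<Theta> 1 \<omega> $ j)"
      by (rule square_integrable_bilinear[OF bounded_bilinear_mult sq\<Theta> sq\<Theta>])
    have cov: "cov_entry M (\<Theta> 1) i j = (\<integral>\<omega>. \<Theta> 1 \<omega> $ i * \<Theta> 1 \<omega> $ j \<partial>M)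
        - (\<integral>\<omega>. \<Theta> 1 \<omega> $ i \<partial>M) * (\<integral>\<omega>. \<Theta> 1 \<omega> $ j \<partial>M)"
      unfolding cov_entry_def by (rule bilinear_covariance[OF bounded_bilinear_mult sq\<Theta> sq\<Theta>])
    show ?thesis
      unfolding mom mm C_def[symmetric] cov using int \<Theta>[of j] by (simp add: left_diff_distrib)
  next
    assume "\<forall>j. integral\<^sup>L M (Ls j 1) = 0"
    then have "b (m i) (m j) = 0" by (simp add: m_def bounded_bilinear.zero_left[OF b])
    then show ?thesis unfolding mom mm C_def[symmetric] by simp
  qed
qed

text \<open>
  Both sides lie in the product space, so it suffices to compare their inner products with its elements \<open>y\<close>.
  The scaling by the mean of \<open>\<Theta>(1)\<close> is moved from the covariance operator of \<open>L(1)\<close> to \<open>y\<close>, where it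
  multiplies the \<open>j\<close>-th column of matrix elements by the mean of \<open>\<Theta>\<^sub>j(1)\<close>.
\<close>

lemma subordinated_covariance:
  assumes Hs: "\<And>j. subspace (Hs j)" "\<And>j. closed (Hs j)"
    and Ls_values: "\<And>j t \<omega>. 0 \<le> t \<Longrightarrow> \<omega> \<in> space M \<Longrightarrow> Ls j t \<omega> \<in> Hs j"
    and sq: "\<And>j t. 0 \<le> t \<Longrightarrow> square_integrable M (Ls j t)"
    and X: "\<And>j. square_integrable M (X j 1)"
    and \<Theta>: "\<And>j. integrable M (\<lambda>\<omega>. \<Theta> 1 \<omega> $ j)"
    and cases: "(\<forall>j. square_integrable M (\<lambda>\<omega>. \<Theta> 1 \<omega> $ j)) \<or> (\<forall>j. integral\<^sup>L M (Ls j 1) = 0)"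
    and x: "x \<in> prod_space Hs"
  shows "cov_op M (prod_space Hs) (subordinated Ls \<Theta> 1) x =
    op_scale (integral\<^sup>L M (\<Theta> 1)) (cov_op M (prod_space Hs) (joint_process Ls 1)) x +
    (\<Sum>i\<in>UNIV. \<Sum>j\<in>UNIV. cov_entry M (\<Theta> 1) i j *\<^sub>R
       tensor_op (axis i (integral\<^sup>L M (Ls i 1))) (axis j (integral\<^sup>L M (Ls j 1))) x)"
    (is "?T x = op_scale ?a ?U x + ?S")
proof (rule eq_if_inner_eq_on_subspace)
  let ?V = "prod_space Hs"
  define m where "m j = integral\<^sup>L M (Ls j 1)" for j
  show V: "subspace ?V" using Hs(1) by (rule subspace_prod_space)
  have cV: "closed ?V" using Hs(2) by (rule closed_prod_space)
  have sqX: "square_integrable M (subordinated Ls \<Theta> 1)"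
    unfolding square_integrable_vec subordinated_nth using X by blast
  have sqL: "square_integrable M (joint_process Ls 1)"
    unfolding square_integrable_vec joint_process_def vec_lambda_beta using sq[OF zero_le_one] by blast
  have XV: "subordinated Ls \<Theta> 1 \<omega> \<in> ?V" if "\<omega> \<in> space M" for \<omega>
    using that Ls_values \<Theta>_nonneg by (simp add: prod_space_def subordinated_nth)
  have LV: "joint_process Ls 1 \<omega> \<in> ?V" if "\<omega> \<in> space M" for \<omega>
    using that Ls_values by (simp add: prod_space_def joint_process_def)
  show "?T x \<in> ?V" by (rule cov_op_in_subspace[OF V cV sqX XV x])
  have mV: "axis j (m j) \<in> ?V" for j
    unfolding m_def
    by (intro axis_in_prod_space Hs integral_in_closed_subspace square_integrable_integrable sq Ls_values) auto
  have UV: "op_scale ?a ?U x \<in> ?V"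
    unfolding op_scale_def
    by (intro coord_scale_in_prod_space Hs cov_op_in_subspace[OF V cV sqL LV x])
  have SV: "?S \<in> ?V"
    unfolding tensor_op_def m_def[symmetric]
    by (intro subspace_sum[OF V] subspace_scale[OF V] mV)
  show "op_scale ?a ?U x + ?S \<in> ?V" by (rule subspace_add[OF V UV SV])
  fix y assume y: "y \<in> ?V"
  have a: "?a $ j = (\<integral>\<omega>. \<Theta> 1 \<omega> $ j \<partial>M)" for j by (rule integral_vec_nth[OF integrable_vec[OF \<Theta>]])
  have "?T x \<bullet> y = (\<Sum>i\<in>UNIV. \<Sum>j\<in>UNIV. (\<integral>\<omega>. (X i 1 \<omega> \<bullet> x $ i) * (X j 1 \<omega> \<bullet> y $ j) \<partial>M)
      - (integral\<^sup>L M (X i 1) \<bullet> x $ i) * (integral\<^sup>L M (X j 1) \<bullet> y $ j))"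
    using cov_op_inner[OF V cV sqX _ x y] XV
    by (simp only: covariance_components[OF sqX] subordinated_nth)
  also have "\<dots> = (\<Sum>i\<in>UNIV. \<Sum>j\<in>UNIV. cov_entry M (\<Theta> 1) i j * ((m i \<bullet> x $ i) * (m j \<bullet> y $ j))
      + ?a $ j * ((\<integral>\<omega>. (Ls i 1 \<omega> \<bullet> x $ i) * (Ls j 1 \<omega> \<bullet> y $ j) \<partial>M) - (m i \<bullet> x $ i) * (m j \<bullet> y $ j)))"
    unfolding m_def a
    by (intro sum.cong refl X_covariance_entry[OF bounded_bilinear_inner_mult sq X \<Theta> cases])
  also have "\<dots> = (\<Sum>i\<in>UNIV. \<Sum>j\<in>UNIV. cov_entry M (\<Theta> 1) i j * ((m i \<bullet> x $ i) * (m j \<bullet> y $ j)))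
      + (\<Sum>i\<in>UNIV. \<Sum>j\<in>UNIV.
        ?a $ j * ((\<integral>\<omega>. (Ls i 1 \<omega> \<bullet> x $ i) * (Ls j 1 \<omega> \<bullet> y $ j) \<partial>M) - (m i \<bullet> x $ i) * (m j \<bullet> y $ j)))"
    by (simp only: sum.distrib)
  also have "(\<Sum>i\<in>UNIV. \<Sum>j\<in>UNIV. cov_entry M (\<Theta> 1) i j * ((m i \<bullet> x $ i) * (m j \<bullet> y $ j))) = ?S \<bullet> y"
    by (simp add: inner_sum_left tensor_op_def inner_axis' m_def mult.assoc)
  also have "(\<Sum>i\<in>UNIV. \<Sum>j\<in>UNIV.
      ?a $ j * ((\<integral>\<omega>. (Ls i 1 \<omega> \<bullet> x $ i) * (Ls j 1 \<omega> \<bullet> y $ j) \<partial>M) - (m i \<bullet> x $ i) * (m j \<bullet> y $ j)))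
    = op_scale ?a ?U x \<bullet> y"
  proof -
    have ay: "coord_scale ?a y \<in> ?V" using Hs(1) y by (rule coord_scale_in_prod_space)
    have U: "?U x \<bullet> coord_scale ?a y =
        (\<integral>\<omega>. ((joint_process Ls 1 \<omega> - integral\<^sup>L M (joint_process Ls 1)) \<bullet> x)
          * ((joint_process Ls 1 \<omega> - integral\<^sup>L M (joint_process Ls 1)) \<bullet> coord_scale ?a y) \<partial>M)"
      by (rule cov_op_inner[OF V cV sqL _ x ay]) (rule LV)
    have "op_scale ?a ?U x \<bullet> y = ?U x \<bullet> coord_scale ?a y"
      unfolding op_scale_def by (rule inner_coord_scale)
    also have "\<dots> = (\<Sum>i\<in>UNIV. \<Sum>j\<in>UNIV.
        (\<integral>\<omega>. (Ls i 1 \<omega> \<bullet> x $ i) * (Ls j 1 \<omega> \<bullet> coord_scale ?a y $ j) \<partial>M)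
        - (m i \<bullet> x $ i) * (m j \<bullet> coord_scale ?a y $ j))"
      unfolding U covariance_components[OF sqL]
      by (simp only: joint_process_def vec_lambda_beta m_def)
    also have "\<dots> = (\<Sum>i\<in>UNIV. \<Sum>j\<in>UNIV.
      ?a $ j * ((\<integral>\<omega>. (Ls i 1 \<omega> \<bullet> x $ i) * (Ls j 1 \<omega> \<bullet> y $ j) \<partial>M) - (m i \<bullet> x $ i) * (m j \<bullet> y $ j)))"
    proof (intro sum.cong refl)
      fix i j :: 'd
      have "(\<integral>\<omega>. (Ls i 1 \<omega> \<bullet> x $ i) * (Ls j 1 \<omega> \<bullet> coord_scale ?a y $ j) \<partial>M)
          = (\<integral>\<omega>. ?a $ j * ((Ls i 1 \<omega> \<bullet> x $ i) * (Ls j 1 \<omega> \<bullet> y $ j)) \<partial>M)"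
        by (simp add: coord_scale_def mult.left_commute)
      then show "(\<integral>\<omega>. (Ls i 1 \<omega> \<bullet> x $ i) * (Ls j 1 \<omega> \<bullet> coord_scale ?a y $ j) \<partial>M)
        - (m i \<bullet> x $ i) * (m j \<bullet> coord_scale ?a y $ j) =
        ?a $ j * ((\<integral>\<omega>. (Ls i 1 \<omega> \<bullet> x $ i) * (Ls j 1 \<omega> \<bullet> y $ j) \<partial>M) - (m i \<bullet> x $ i) * (m j \<bullet> y $ j))"
        by (simp add: coord_scale_def right_diff_distrib mult.left_commute)
    qed
    finally show ?thesis by (rule sym)
  qed
  finally show "?T x \<bullet> y = (op_scale ?a ?U x + ?S) \<bullet> y" by (simp only: inner_add_left add.commute)
qed

end

theorem theorem3p7:
  fixes M :: "'w measure"
    and Hs :: "'d::finite \<Rightarrow> 'a::{real_inner, banach, second_countable_topology} set"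
    and Ls :: "'d \<Rightarrow> real \<Rightarrow> 'w \<Rightarrow> 'a"
    and \<Theta> :: "real \<Rightarrow> 'w \<Rightarrow> real ^ 'd"
  assumes prob: "prob_space M"
    and Hs: "\<And>j. subspace (Hs j)" "\<And>j. closed (Hs j)"
    and Ls_values: "\<And>j t \<omega>. 0 \<le> t \<Longrightarrow> \<omega> \<in> space M \<Longrightarrow> Ls j t \<omega> \<in> Hs j"
    and Ls_levy: "\<And>j. levy_process M (Ls j)" "\<And>j. cadlag_process M (Ls j)"
    and Ls_indep: "prob_space.indep_sets M (\<lambda>j. process_events M (Ls j)) UNIV"
    and \<Theta>_levy: "levy_process M \<Theta>" "cadlag_process M \<Theta>"
    and \<Theta>_subordinator: "\<And>j. subordinator M (\<lambda>t \<omega>. \<Theta> t \<omega> $ j)"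
    and \<Theta>_Ls_indep:
      "prob_space.indep_set M (process_events M \<Theta>) (process_events M (joint_process Ls))"
  shows
    "(square_integrable_process M (subordinated Ls \<Theta>) \<longleftrightarrow>
        (\<forall>j. square_integrable_process M (\<lambda>t \<omega>. subordinated Ls \<Theta> t \<omega> $ j))) \<and>
     (\<forall>j. square_integrable_process M (\<lambda>t \<omega>. subordinated Ls \<Theta> t \<omega> $ j) \<longleftrightarrow>
        (square_integrable_process M (Ls j) \<and>
           square_integrable_process M (\<lambda>t \<omega>. \<Theta> t \<omega> $ j)) \<or>
        (mean_zero_process M (Ls j) \<and> square_integrable_process M (Ls j) \<and>
           integrable_process M (\<lambda>t \<omega>. \<Theta> t \<omega> $ j)) \<or>
        zero_process M (\<lambda>t \<omega>. \<Theta> t \<omega> $ j) \<or>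
        zero_process M (Ls j)) \<and>
     (\<forall>j. mean_zero_process M (\<lambda>t \<omega>. subordinated Ls \<Theta> t \<omega> $ j) \<and>
          square_integrable_process M (\<lambda>t \<omega>. subordinated Ls \<Theta> t \<omega> $ j) \<longleftrightarrow>
        (mean_zero_process M (Ls j) \<and> square_integrable_process M (Ls j) \<and>
           integrable_process M (\<lambda>t \<omega>. \<Theta> t \<omega> $ j)) \<or>
        zero_process M (\<lambda>t \<omega>. \<Theta> t \<omega> $ j) \<or>
        zero_process M (Ls j)) \<and>
     ((\<forall>j. square_integrable_process M (Ls j) \<and>
           square_integrable_process M (\<lambda>t \<omega>. \<Theta> t \<omega> $ j)) \<longrightarrow>
        integral\<^sup>L M (subordinated Ls \<Theta> 1) =
          coord_scale (integral\<^sup>L M (\<Theta> 1)) (integral\<^sup>L M (joint_process Ls 1)) \<and>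
        (\<forall>x\<in>prod_space Hs.
          cov_op M (prod_space Hs) (subordinated Ls \<Theta> 1) x =
            op_scale (integral\<^sup>L M (\<Theta> 1)) (cov_op M (prod_space Hs) (joint_process Ls 1)) x +
            (\<Sum>i\<in>UNIV. \<Sum>j\<in>UNIV. cov_entry M (\<Theta> 1) i j *\<^sub>R
               tensor_op (axis i (integral\<^sup>L M (Ls i 1))) (axis j (integral\<^sup>L M (Ls j 1))) x))) \<and>
     ((\<forall>j. mean_zero_process M (Ls j) \<and> square_integrable_process M (Ls j) \<and>
           integrable_process M (\<lambda>t \<omega>. \<Theta> t \<omega> $ j)) \<longrightarrow>
        (\<forall>x\<in>prod_space Hs.
          cov_op M (prod_space Hs) (subordinated Ls \<Theta> 1) x =
            op_scale (integral\<^sup>L M (\<Theta> 1)) (cov_op M (prod_space Hs) (joint_process Ls 1)) x))"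
proof -
  interpret prob_space M by (rule prob)
  interpret time_changed_levy M Ls \<Theta>
  proof
    show "0 \<le> \<Theta> t \<omega> $ j" if "0 \<le> t" "\<omega> \<in> space M" for t \<omega> j
      using \<Theta>_subordinator[of j] that unfolding subordinator_def by blast
  qed (fact Ls_levy Ls_indep \<Theta>_levy(2) \<Theta>_Ls_indep levy_process_measurable[OF \<Theta>_levy(1)])+
  show ?thesis
  proof (intro conjI impI)
    show "square_integrable_process M (subordinated Ls \<Theta>) \<longleftrightarrow>
        (\<forall>j. square_integrable_process M (\<lambda>t \<omega>. subordinated Ls \<Theta> t \<omega> $ j))"
      unfolding square_integrable_process_iff square_integrable_vec by blast
    show "\<forall>j. square_integrable_process M (\<lambda>t \<omega>. subordinated Ls \<Theta> t \<omega> $ j) \<longleftrightarrow>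
        (square_integrable_process M (Ls j) \<and>
           square_integrable_process M (\<lambda>t \<omega>. \<Theta> t \<omega> $ j)) \<or>
        (mean_zero_process M (Ls j) \<and> square_integrable_process M (Ls j) \<and>
           integrable_process M (\<lambda>t \<omega>. \<Theta> t \<omega> $ j)) \<or>
        zero_process M (\<lambda>t \<omega>. \<Theta> t \<omega> $ j) \<or>
        zero_process M (Ls j)"
      unfolding subordinated_nth by (intro allI X_square_integrable_process_iff)
    show "\<forall>j. mean_zero_process M (\<lambda>t \<omega>. subordinated Ls \<Theta> t \<omega> $ j) \<and>
          square_integrable_process M (\<lambda>t \<omega>. subordinated Ls \<Theta> t \<omega> $ j) \<longleftrightarrow>
        (mean_zero_process M (Ls j) \<and> square_integrable_process M (Ls j) \<and>
           integrable_process M (\<lambda>t \<omega>. \<Theta> t \<omega> $ j)) \<or>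
        zero_process M (\<lambda>t \<omega>. \<Theta> t \<omega> $ j) \<or>
        zero_process M (Ls j)"
      unfolding subordinated_nth by (intro allI X_mean_zero_square_integrable_process_iff)
  next
    assume 1: "\<forall>j. square_integrable_process M (Ls j) \<and> square_integrable_process M (\<lambda>t \<omega>. \<Theta> t \<omega> $ j)"
    then have sq: "square_integrable M (Ls j t)" "square_integrable M (\<lambda>\<omega>. \<Theta> t \<omega> $ j)" if "0 \<le> t" for j t
      using that unfolding square_integrable_process_iff by blast+
    have X: "square_integrable M (X j 1)" for j
      using 1 X_square_integrable_if_square_integrable[of j 1] by simp
    have \<Theta>: "integrable M (\<lambda>\<omega>. \<Theta> 1 \<omega> $ j)" for j
      by (rule square_integrable_integrable[OF sq(2)[OF zero_le_one]])
    show "integral\<^sup>L M (subordinated Ls \<Theta> 1) =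
        coord_scale (integral\<^sup>L M (\<Theta> 1)) (integral\<^sup>L M (joint_process Ls 1))"
      by (rule subordinated_mean[OF sq(1) X \<Theta>])
    show "\<forall>x\<in>prod_space Hs. cov_op M (prod_space Hs) (subordinated Ls \<Theta> 1) x =
        op_scale (integral\<^sup>L M (\<Theta> 1)) (cov_op M (prod_space Hs) (joint_process Ls 1)) x +
        (\<Sum>i\<in>UNIV. \<Sum>j\<in>UNIV. cov_entry M (\<Theta> 1) i j *\<^sub>R
           tensor_op (axis i (integral\<^sup>L M (Ls i 1))) (axis j (integral\<^sup>L M (Ls j 1))) x)"
      using sq(2)[OF zero_le_one] by (intro ballI subordinated_covariance Hs Ls_values sq X \<Theta>) auto
  next
    assume 2: "\<forall>j. mean_zero_process M (Ls j) \<and> square_integrable_process M (Ls j) \<and>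
        integrable_process M (\<lambda>t \<omega>. \<Theta> t \<omega> $ j)"
    then have sq: "square_integrable M (Ls j t)" if "0 \<le> t" for j t
      using that unfolding square_integrable_process_iff by blast
    have X: "square_integrable M (X j 1)" for j
      using 2 X_square_integrable_if_mean_zero(1)[of j 1] by simp
    have \<Theta>: "integrable M (\<lambda>\<omega>. \<Theta> 1 \<omega> $ j)" for j
      using 2 zero_le_one unfolding integrable_process_def by blast
    have m: "integral\<^sup>L M (Ls j 1) = 0" for j
      using 2 zero_le_one unfolding mean_zero_process_def by blast
    show "\<forall>x\<in>prod_space Hs. cov_op M (prod_space Hs) (subordinated Ls \<Theta> 1) x =
        op_scale (integral\<^sup>L M (\<Theta> 1)) (cov_op M (prod_space Hs) (joint_process Ls 1)) x"
    proof
      fix x assume x: "x \<in> prod_space Hs"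
      have axis_0: "axis i 0 = (0 :: 'a ^ 'd)" for i by (simp add: vec_eq_iff axis_def)
      show "cov_op M (prod_space Hs) (subordinated Ls \<Theta> 1) x =
        op_scale (integral\<^sup>L M (\<Theta> 1)) (cov_op M (prod_space Hs) (joint_process Ls 1)) x"
        using subordinated_covariance[OF Hs Ls_values sq X \<Theta> disjI2 x] m by (simp add: tensor_op_def axis_0)
    qed
  qed
qed

end
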